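(* Let $\Bbbk=\mathbb{R}$ or $\mathbb{C}$, let $V_1,\dots,V_k$ be $\Bbbk$-vector spaces and let $U_i\le V_i$ be linear subspaces for $i=1,\dots,k$. Let $B,B'\in U_1\otimes\dots\otimes U_k\subseteq V_1\otimes\dots\otimes V_k$. (1) If $B,B'$ are in distinct $\mathrm{GL}(U_1)\times\dots\times\mathrm{GL}(U_k)$-orbits of $U_1\otimes\dots\otimes U_k$, then $B$ and $B'$ are in distinct $\mathrm{GL}(V_1)\times\dots\times\mathrm{GL}(V_k)$-orbits of $V_1\otimes\dots\otimes V_k$. (2) Suppose in addition that the $V_i$ are inner-product spaces (and the $U_i$ carry the induced inner products). If $B,B'$ are in distinct $\mathrm{O}(U_1)\times\dots\times\mathrm{O}(U_k)$-orbits of $U_1\otimes\dots\otimes U_k$, then $B$ and $B'$ are in distinct $\mathrm{O}(V_1)\times\dots\times\mathrm{O}(V_k)$-orbits of $V_1\otimes\dots\otimes V_k$.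
   Context: $\mathrm{GL}(V)$ is the group of invertible linear maps $V\to V$; if $V$ is an inner-product space, $\mathrm{O}(V)$ is the group of (invertible) norm-preserving linear maps $V\to V$. The inclusion $U_1\otimes\dots\otimes U_k\subseteq V_1\otimes\dots\otimes V_k$ is the tensor product of the inclusions $U_i\subseteq V_i$. The product groups act factorwise: $(L_1,\dots,L_k)\cdot(\mathbf{x}_1\otimes\dots\otimes\mathbf{x}_k)=L_1\mathbf{x}_1\otimes\dots\otimes L_k\mathbf{x}_k$, extended linearly. *)

theory Defs
  imports Complex_Main "HOL-Library.Poly_Mapping" "HOL-Algebra.Module"
    "HOL-Algebra.Group_Action" "HOL-Algebra.Product_Groups"
begin

section \<open>Scalars and vector spaces\<close>

text \<open>
  Both scalar fields are carried by subsets of the complex numbers: \<open>K = \<real>\<close> (the real axis) or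
  \<open>K = UNIV\<close>. A \<open>K\<close>-vector space is a \<open>module (scalars K) V\<close> in the sense of HOL-Algebra, so
  that the spaces of a family \<open>V 1, \<dots>, V k\<close> may have different carriers and operations.
  The ring multiplication that a \<open>module\<close> record also contains plays no role.
\<close>

definition scalars :: "complex set \<Rightarrow> complex ring"
  where "scalars K = \<lparr>carrier = K, mult = (*), one = 1, zero = 0, add = (+)\<rparr>"

lemma scalars_simps [simp]:
  "carrier (scalars K) = K" "mult (scalars K) = (*)" "one (scalars K) = 1"
  "zero (scalars K) = 0" "add (scalars K) = (+)"
  by (simp_all add: scalars_def)

lemma field_scalars:
  assumes "K = \<real> \<or> K = UNIV"
  shows "field (scalars K)"
proof -
  have closed: "0 \<in> K" "1 \<in> K" "\<And>x y. x \<in> K \<Longrightarrow> y \<in> K \<Longrightarrow> x + y \<in> K"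
    "\<And>x y. x \<in> K \<Longrightarrow> y \<in> K \<Longrightarrow> x * y \<in> K" "\<And>x. x \<in> K \<Longrightarrow> - x \<in> K"
    "\<And>x. x \<in> K \<Longrightarrow> inverse x \<in> K"
    using assms by auto
  have "cring (scalars K)"
  proof (rule cringI)
    show "abelian_group (scalars K)"
      by (rule abelian_groupI) (auto simp: closed add_eq_0_iff2 intro!: bexI[of _ "- _"])
    show "comm_monoid (scalars K)"
      by (rule comm_monoidI) (auto simp: closed)
  qed (auto simp: algebra_simps)
  then show ?thesis
    by (rule cring.cring_fieldI2) (simp_all, metis closed(6) right_inverse)
qed

definition linear_maps ::
    "complex set \<Rightarrow> (complex, 'v) module \<Rightarrow> (complex, 'w) module \<Rightarrow> ('v \<Rightarrow> 'w) set"
  where "linear_maps K V W = {f \<in> carrier V \<rightarrow> carrier W.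
    (\<forall>x\<in>carrier V. \<forall>y\<in>carrier V. f (x \<oplus>\<^bsub>V\<^esub> y) = f x \<oplus>\<^bsub>W\<^esub> f y) \<and>
    (\<forall>c\<in>K. \<forall>x\<in>carrier V. f (c \<odot>\<^bsub>V\<^esub> x) = c \<odot>\<^bsub>W\<^esub> f x)}"

definition GL_group :: "complex set \<Rightarrow> (complex, 'v) module \<Rightarrow> ('v \<Rightarrow> 'v) monoid"
  where "GL_group K V =
    BijGroup (carrier V) \<lparr>carrier := Bij (carrier V) \<inter> linear_maps K V V\<rparr>"

text \<open>
  For \<open>K = \<real>\<close> the second clause below is plain symmetry. It makes \<open>ip x x\<close> real.
\<close>

definition inner_product :: "complex set \<Rightarrow> (complex, 'v) module \<Rightarrow> ('v \<Rightarrow> 'v \<Rightarrow> complex) \<Rightarrow> bool"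
  where "inner_product K V ip \<longleftrightarrow>
    (\<forall>x\<in>carrier V. \<forall>y\<in>carrier V. ip x y \<in> K) \<and>
    (\<forall>x\<in>carrier V. \<forall>y\<in>carrier V. ip y x = cnj (ip x y)) \<and>
    (\<forall>x\<in>carrier V. \<forall>y\<in>carrier V. \<forall>z\<in>carrier V. ip (x \<oplus>\<^bsub>V\<^esub> y) z = ip x z + ip y z) \<and>
    (\<forall>c\<in>K. \<forall>x\<in>carrier V. \<forall>y\<in>carrier V. ip (c \<odot>\<^bsub>V\<^esub> x) y = c * ip x y) \<and>
    (\<forall>x\<in>carrier V. x \<noteq> \<zero>\<^bsub>V\<^esub> \<longrightarrow> Re (ip x x) > 0)"

definition ip_norm :: "('v \<Rightarrow> 'v \<Rightarrow> complex) \<Rightarrow> 'v \<Rightarrow> real"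
  where "ip_norm ip x = sqrt (Re (ip x x))"

definition O_group ::
    "complex set \<Rightarrow> (complex, 'v) module \<Rightarrow> ('v \<Rightarrow> 'v \<Rightarrow> complex) \<Rightarrow> ('v \<Rightarrow> 'v) monoid"
  where "O_group K V ip = GL_group K V
    \<lparr>carrier := {f \<in> carrier (GL_group K V). \<forall>x\<in>carrier V. ip_norm ip (f x) = ip_norm ip x}\<rparr>"


section \<open>Tensor products of finite families\<close>

text \<open>
  The tensor product of the family \<open>V i\<close> (\<open>i \<in> I\<close>) is the free \<open>K\<close>-vector space on the tuples in
  \<open>\<Pi>\<^sub>E i\<in>I. carrier (V i)\<close> modulo the subspace spanned by the multilinearity relations.
\<close>

definition free_space :: "complex set \<Rightarrow> 'a set \<Rightarrow> ('a \<Rightarrow>\<^sub>0 complex) set"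
  where "free_space K X = {p. Poly_Mapping.keys p \<subseteq> X \<and> (\<forall>x. Poly_Mapping.lookup p x \<in> K)}"

inductive_set tensor_relations ::
    "complex set \<Rightarrow> 'i set \<Rightarrow> ('i \<Rightarrow> (complex, 'v) module) \<Rightarrow> (('i \<Rightarrow> 'v) \<Rightarrow>\<^sub>0 complex) set"
  for K I V where
  zero: "0 \<in> tensor_relations K I V"
| plus: "p \<in> tensor_relations K I V \<Longrightarrow> q \<in> tensor_relations K I V \<Longrightarrow> p + q \<in> tensor_relations K I V"
| scale: "c \<in> K \<Longrightarrow> p \<in> tensor_relations K I V \<Longrightarrow>
    Poly_Mapping.map ((*) c) p \<in> tensor_relations K I V"
| additive: "x \<in> (\<Pi>\<^sub>E i\<in>I. carrier (V i)) \<Longrightarrow> i \<in> I \<Longrightarrow> a \<in> carrier (V i) \<Longrightarrow> b \<in> carrier (V i) \<Longrightarrow>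
    Poly_Mapping.single (x(i := a \<oplus>\<^bsub>V i\<^esub> b)) 1
      - (Poly_Mapping.single (x(i := a)) 1 + Poly_Mapping.single (x(i := b)) 1)
    \<in> tensor_relations K I V"
| homogeneous: "x \<in> (\<Pi>\<^sub>E i\<in>I. carrier (V i)) \<Longrightarrow> i \<in> I \<Longrightarrow> c \<in> K \<Longrightarrow> a \<in> carrier (V i) \<Longrightarrow>
    Poly_Mapping.single (x(i := c \<odot>\<^bsub>V i\<^esub> a)) 1 - Poly_Mapping.single (x(i := a)) c
    \<in> tensor_relations K I V"

definition tensor_eq :: "complex set \<Rightarrow> 'i set \<Rightarrow> ('i \<Rightarrow> (complex, 'v) module) \<Rightarrow>
    ((('i \<Rightarrow> 'v) \<Rightarrow>\<^sub>0 complex) \<times> (('i \<Rightarrow> 'v) \<Rightarrow>\<^sub>0 complex)) set"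
  where "tensor_eq K I V = {(p, q).
    p \<in> free_space K (\<Pi>\<^sub>E i\<in>I. carrier (V i)) \<and> q \<in> free_space K (\<Pi>\<^sub>E i\<in>I. carrier (V i)) \<and>
    p - q \<in> tensor_relations K I V}"

definition tensor_product :: "complex set \<Rightarrow> 'i set \<Rightarrow> ('i \<Rightarrow> (complex, 'v) module) \<Rightarrow>
    (complex, (('i \<Rightarrow> 'v) \<Rightarrow>\<^sub>0 complex) set) module"
  where "tensor_product K I V =
    \<lparr>carrier = free_space K (\<Pi>\<^sub>E i\<in>I. carrier (V i)) // tensor_eq K I V,
     mult = undefined, one = undefined,
     zero = tensor_eq K I V `` {0},
     add = (\<lambda>X Y. \<Union>p\<in>X. \<Union>q\<in>Y. tensor_eq K I V `` {p + q}),
     smult = (\<lambda>c X. \<Union>p\<in>X. tensor_eq K I V `` {Poly_Mapping.map ((*) c) p})\<rparr>"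

definition pure_tensor :: "complex set \<Rightarrow> 'i set \<Rightarrow> ('i \<Rightarrow> (complex, 'v) module) \<Rightarrow>
    ('i \<Rightarrow> 'v) \<Rightarrow> (('i \<Rightarrow> 'v) \<Rightarrow>\<^sub>0 complex) set"
  where "pure_tensor K I V x = tensor_eq K I V `` {Poly_Mapping.single x 1}"

definition free_map :: "'i set \<Rightarrow> ('i \<Rightarrow> 'v \<Rightarrow> 'w) \<Rightarrow>
    (('i \<Rightarrow> 'v) \<Rightarrow>\<^sub>0 complex) \<Rightarrow> (('i \<Rightarrow> 'w) \<Rightarrow>\<^sub>0 complex)"
  where "free_map I f p =
    (\<Sum>x\<in>Poly_Mapping.keys p. Poly_Mapping.single (\<lambda>i\<in>I. f i (x i)) (Poly_Mapping.lookup p x))"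

text \<open>
  The tensor product of linear maps \<open>f i : V i \<rightarrow> W i\<close>. The lemmas \<open>tensor_map_linear\<close> and
  \<open>tensor_map_pure\<close> below say that it is the linear extension of
  \<open>x\<^sub>1 \<otimes> \<dots> \<otimes> x\<^sub>k \<mapsto> f\<^sub>1 x\<^sub>1 \<otimes> \<dots> \<otimes> f\<^sub>k x\<^sub>k\<close>.
\<close>

definition tensor_map :: "complex set \<Rightarrow> 'i set \<Rightarrow>
    ('i \<Rightarrow> (complex, 'v) module) \<Rightarrow> ('i \<Rightarrow> (complex, 'w) module) \<Rightarrow> ('i \<Rightarrow> 'v \<Rightarrow> 'w) \<Rightarrow>
    (('i \<Rightarrow> 'v) \<Rightarrow>\<^sub>0 complex) set \<Rightarrow> (('i \<Rightarrow> 'w) \<Rightarrow>\<^sub>0 complex) set"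
  where "tensor_map K I V W f X = (\<Union>p\<in>X. tensor_eq K I W `` {free_map I f p})"

text \<open>A linear subspace, as a vector space with the inherited operations.\<close>

definition subspace_of :: "(complex, 'v) module \<Rightarrow> 'v set \<Rightarrow> (complex, 'v) module"
  where "subspace_of V U = V\<lparr>carrier := U\<rparr>"

definition tensor_inclusion :: "complex set \<Rightarrow> 'i set \<Rightarrow> ('i \<Rightarrow> 'v set) \<Rightarrow>
    ('i \<Rightarrow> (complex, 'v) module) \<Rightarrow> (('i \<Rightarrow> 'v) \<Rightarrow>\<^sub>0 complex) set \<Rightarrow> (('i \<Rightarrow> 'v) \<Rightarrow>\<^sub>0 complex) set"
  where "tensor_inclusion K I U V = tensor_map K I (\<lambda>i. subspace_of (V i) (U i)) V (\<lambda>i x. x)"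

text \<open>
  The orbits of the factorwise actions of \<open>\<Prod>i\<in>I. GL (V i)\<close> and \<open>\<Prod>i\<in>I. O (V i)\<close> on the
  tensor product of the \<open>V i\<close>.
\<close>

definition GL_orbit :: "complex set \<Rightarrow> 'i set \<Rightarrow> ('i \<Rightarrow> (complex, 'v) module) \<Rightarrow>
    (('i \<Rightarrow> 'v) \<Rightarrow>\<^sub>0 complex) set \<Rightarrow> (('i \<Rightarrow> 'v) \<Rightarrow>\<^sub>0 complex) set set"
  where "GL_orbit K I V =
    orbit (product_group I (\<lambda>i. GL_group K (V i))) (tensor_map K I V V)"

definition O_orbit :: "complex set \<Rightarrow> 'i set \<Rightarrow> ('i \<Rightarrow> (complex, 'v) module) \<Rightarrow>
    ('i \<Rightarrow> 'v \<Rightarrow> 'v \<Rightarrow> complex) \<Rightarrow>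
    (('i \<Rightarrow> 'v) \<Rightarrow>\<^sub>0 complex) set \<Rightarrow> (('i \<Rightarrow> 'v) \<Rightarrow>\<^sub>0 complex) set set"
  where "O_orbit K I V ip =
    orbit (product_group I (\<lambda>i. O_group K (V i) (ip i))) (tensor_map K I V V)"


section \<open>Basic properties of the tensor product\<close>

lemma lookup_scale [simp]:
  "Poly_Mapping.lookup (Poly_Mapping.map ((*) c) p) x = c * Poly_Mapping.lookup p (x :: 'a)"
  for c :: complex
  by (simp add: Poly_Mapping.map.rep_eq when_def)

lemma keys_scale: "Poly_Mapping.keys (Poly_Mapping.map ((*) (c :: complex)) p) \<subseteq> Poly_Mapping.keys p"
  by (auto simp: in_keys_iff)

context
  fixes K :: "complex set"
  assumes K: "K = \<real> \<or> K = UNIV"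
begin

private lemma closed:
  "0 \<in> K" "1 \<in> K" "x \<in> K \<Longrightarrow> y \<in> K \<Longrightarrow> x + y \<in> K" "x \<in> K \<Longrightarrow> y \<in> K \<Longrightarrow> x * y \<in> K"
  "x \<in> K \<Longrightarrow> - x \<in> K" "x \<in> K \<Longrightarrow> y \<in> K \<Longrightarrow> x - y \<in> K"
  using K by auto

lemma free_space_closed:
  "0 \<in> free_space K X"
  "p \<in> free_space K X \<Longrightarrow> q \<in> free_space K X \<Longrightarrow> p + q \<in> free_space K X"
  "p \<in> free_space K X \<Longrightarrow> q \<in> free_space K X \<Longrightarrow> p - q \<in> free_space K X"
  "c \<in> K \<Longrightarrow> p \<in> free_space K X \<Longrightarrow> Poly_Mapping.map ((*) c) p \<in> free_space K X"
  "c \<in> K \<Longrightarrow> x \<in> X \<Longrightarrow> Poly_Mapping.single x c \<in> free_space K X"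
  using closed keys_add[of p q] keys_diff[of p q] keys_scale[of c p]
  by (auto simp: free_space_def lookup_add lookup_minus lookup_single when_def)

lemma tensor_relations_uminus:
  "p \<in> tensor_relations K I V \<Longrightarrow> - p \<in> tensor_relations K I V"
proof -
  assume "p \<in> tensor_relations K I V"
  then have "Poly_Mapping.map ((*) (- 1)) p \<in> tensor_relations K I V"
    by (rule tensor_relations.scale[rotated]) (simp add: closed)
  moreover have "Poly_Mapping.map ((*) (- 1)) p = - p"
    by (rule poly_mapping_eqI) simp
  ultimately show ?thesis by simp
qed

lemma equiv_tensor_eq: "equiv (free_space K (\<Pi>\<^sub>E i\<in>I. carrier (V i))) (tensor_eq K I V)"
proof (rule equivI)
  show "tensor_eq K I V \<subseteq> free_space K (\<Pi>\<^sub>E i\<in>I. carrier (V i)) \<times> free_space K (\<Pi>\<^sub>E i\<in>I. carrier (V i))"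
    by (auto simp: tensor_eq_def)
  show "refl_on (free_space K (\<Pi>\<^sub>E i\<in>I. carrier (V i))) (tensor_eq K I V)"
    by (auto simp: tensor_eq_def refl_on_def tensor_relations.zero)
  show "sym (tensor_eq K I V)"
    using tensor_relations_uminus by (force simp: tensor_eq_def sym_def)
  show "trans (tensor_eq K I V)"
  proof (rule transI)
    fix p q r assume "(p, q) \<in> tensor_eq K I V" "(q, r) \<in> tensor_eq K I V"
    then show "(p, r) \<in> tensor_eq K I V"
      using tensor_relations.plus[of "p - q" K I V "q - r"] by (auto simp: tensor_eq_def)
  qed
qed

lemma tensor_class_eq_iff:
  assumes "p \<in> free_space K (\<Pi>\<^sub>E i\<in>I. carrier (V i))" "q \<in> free_space K (\<Pi>\<^sub>E i\<in>I. carrier (V i))"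
  shows "tensor_eq K I V `` {p} = tensor_eq K I V `` {q} \<longleftrightarrow> p - q \<in> tensor_relations K I V"
  using eq_equiv_class_iff[OF equiv_tensor_eq assms] assms by (auto simp: tensor_eq_def)

lemma tensor_add_class:
  assumes "p \<in> free_space K (\<Pi>\<^sub>E i\<in>I. carrier (V i))" "q \<in> free_space K (\<Pi>\<^sub>E i\<in>I. carrier (V i))"
  shows "tensor_eq K I V `` {p} \<oplus>\<^bsub>tensor_product K I V\<^esub> tensor_eq K I V `` {q}
    = tensor_eq K I V `` {p + q}"
proof -
  have "congruent2 (tensor_eq K I V) (tensor_eq K I V) (\<lambda>p q. tensor_eq K I V `` {p + q})"
  proof (rule congruent2I')
    fix p q p' q' assume "(p, p') \<in> tensor_eq K I V" "(q, q') \<in> tensor_eq K I V"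
    then show "tensor_eq K I V `` {p + q} = tensor_eq K I V `` {p' + q'}"
      using tensor_relations.plus[of "p - p'" K I V "q - q'"]
      by (subst tensor_class_eq_iff) (auto simp: tensor_eq_def free_space_closed algebra_simps)
  qed
  from UN_equiv_class2[OF equiv_tensor_eq equiv_tensor_eq this assms] show ?thesis
    by (simp add: tensor_product_def)
qed

lemma tensor_smult_class:
  assumes "c \<in> K" "p \<in> free_space K (\<Pi>\<^sub>E i\<in>I. carrier (V i))"
  shows "c \<odot>\<^bsub>tensor_product K I V\<^esub> (tensor_eq K I V `` {p})
    = tensor_eq K I V `` {Poly_Mapping.map ((*) c) p}"
proof -
  have minus: "Poly_Mapping.map ((*) c) p - Poly_Mapping.map ((*) c) q = Poly_Mapping.map ((*) c) (p - q)"
    for p q :: "('a \<Rightarrow> 'b) \<Rightarrow>\<^sub>0 complex"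
    by (rule poly_mapping_eqI) (simp add: lookup_minus algebra_simps)
  have "congruent (tensor_eq K I V) (\<lambda>p. tensor_eq K I V `` {Poly_Mapping.map ((*) c) p})"
    using \<open>c \<in> K\<close>
    by (intro congruentI, subst tensor_class_eq_iff)
      (auto simp: tensor_eq_def free_space_closed minus intro: tensor_relations.scale)
  from UN_equiv_class[OF equiv_tensor_eq this assms(2)] show ?thesis
    by (simp add: tensor_product_def)
qed

lemma tensor_product_cases:
  assumes "X \<in> carrier (tensor_product K I V)"
  obtains p where "p \<in> free_space K (\<Pi>\<^sub>E i\<in>I. carrier (V i))" "X = tensor_eq K I V `` {p}"
  using assms by (auto simp: tensor_product_def quotient_def)

lemma tensor_class_closed:
  "p \<in> free_space K (\<Pi>\<^sub>E i\<in>I. carrier (V i)) \<Longrightarrow> tensor_eq K I V `` {p} \<in> carrier (tensor_product K I V)"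
  by (auto simp: tensor_product_def quotient_def)

theorem tensor_product_module: "module (scalars K) (tensor_product K I V)"
proof (rule moduleI)
  let ?F = "free_space K (\<Pi>\<^sub>E i\<in>I. carrier (V i))" and ?T = "tensor_product K I V"
  have zero: "\<zero>\<^bsub>?T\<^esub> = tensor_eq K I V `` {0}"
    by (simp add: tensor_product_def)
  note simps = tensor_add_class tensor_smult_class free_space_closed tensor_class_closed closed
  have scale: "Poly_Mapping.map ((*) (a + b)) p = Poly_Mapping.map ((*) a) p + Poly_Mapping.map ((*) b) p"
    "Poly_Mapping.map ((*) a) (p + q) = Poly_Mapping.map ((*) a) p + Poly_Mapping.map ((*) a) q"
    "Poly_Mapping.map ((*) (a * b)) p = Poly_Mapping.map ((*) a) (Poly_Mapping.map ((*) b) p)"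
    "Poly_Mapping.map ((*) 1) p = p"
    for a b :: complex and p q :: "('a \<Rightarrow> 'b) \<Rightarrow>\<^sub>0 complex"
    by (auto intro!: poly_mapping_eqI simp: lookup_add algebra_simps)
  show "cring (scalars K)"
    using field_scalars[OF K] by (simp add: field_def domain_def)
  show "abelian_group ?T"
  proof (rule abelian_groupI)
    fix X assume "X \<in> carrier ?T"
    then obtain p where p: "p \<in> ?F" "X = tensor_eq K I V `` {p}"
      by (rule tensor_product_cases)
    then have "- p \<in> ?F"
      using free_space_closed(3)[OF free_space_closed(1) p(1)] by simp
    with p show "\<exists>Y\<in>carrier ?T. Y \<oplus>\<^bsub>?T\<^esub> X = \<zero>\<^bsub>?T\<^esub>"
      by (intro bexI[of _ "tensor_eq K I V `` {- p}"]) (simp_all add: simps zero)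
  qed (elim tensor_product_cases; simp add: simps zero add_ac | simp add: simps zero)+
  show "a \<odot>\<^bsub>?T\<^esub> X \<in> carrier ?T" if "a \<in> carrier (scalars K)" "X \<in> carrier ?T" for a X
    using that by (elim tensor_product_cases) (simp add: simps)
  show "(a \<oplus>\<^bsub>scalars K\<^esub> b) \<odot>\<^bsub>?T\<^esub> X = a \<odot>\<^bsub>?T\<^esub> X \<oplus>\<^bsub>?T\<^esub> b \<odot>\<^bsub>?T\<^esub> X"
    if "a \<in> carrier (scalars K)" "b \<in> carrier (scalars K)" "X \<in> carrier ?T" for a b X
    using that by (elim tensor_product_cases) (simp add: simps scale)
  show "a \<odot>\<^bsub>?T\<^esub> (X \<oplus>\<^bsub>?T\<^esub> Y) = a \<odot>\<^bsub>?T\<^esub> X \<oplus>\<^bsub>?T\<^esub> a \<odot>\<^bsub>?T\<^esub> Y"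
    if "a \<in> carrier (scalars K)" "X \<in> carrier ?T" "Y \<in> carrier ?T" for a X Y
    using that by (elim tensor_product_cases) (simp add: simps scale)
  show "(a \<otimes>\<^bsub>scalars K\<^esub> b) \<odot>\<^bsub>?T\<^esub> X = a \<odot>\<^bsub>?T\<^esub> (b \<odot>\<^bsub>?T\<^esub> X)"
    if "a \<in> carrier (scalars K)" "b \<in> carrier (scalars K)" "X \<in> carrier ?T" for a b X
    using that by (elim tensor_product_cases) (simp add: simps scale)
  show "\<one>\<^bsub>scalars K\<^esub> \<odot>\<^bsub>?T\<^esub> X = X" if "X \<in> carrier ?T" for X
    using that by (elim tensor_product_cases) (simp add: simps scale)
qed

theorem pure_tensor_multilinear:
  assumes "x \<in> (\<Pi>\<^sub>E i\<in>I. carrier (V i))" "i \<in> I" "module (scalars K) (V i)"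
  shows "a \<in> carrier (V i) \<Longrightarrow> b \<in> carrier (V i) \<Longrightarrow>
      pure_tensor K I V (x(i := a \<oplus>\<^bsub>V i\<^esub> b))
        = pure_tensor K I V (x(i := a)) \<oplus>\<^bsub>tensor_product K I V\<^esub> pure_tensor K I V (x(i := b))"
    and "c \<in> K \<Longrightarrow> a \<in> carrier (V i) \<Longrightarrow>
      pure_tensor K I V (x(i := c \<odot>\<^bsub>V i\<^esub> a))
        = c \<odot>\<^bsub>tensor_product K I V\<^esub> pure_tensor K I V (x(i := a))"
proof -
  interpret module "scalars K" "V i" by fact
  have upd: "Poly_Mapping.single (x(i := a)) c \<in> free_space K (\<Pi>\<^sub>E i\<in>I. carrier (V i))"
    if "a \<in> carrier (V i)" "c \<in> K" for a c
    using that assms by (intro free_space_closed) (auto simp: PiE_iff extensional_def)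
  show "pure_tensor K I V (x(i := a \<oplus>\<^bsub>V i\<^esub> b))
      = pure_tensor K I V (x(i := a)) \<oplus>\<^bsub>tensor_product K I V\<^esub> pure_tensor K I V (x(i := b))"
    if "a \<in> carrier (V i)" "b \<in> carrier (V i)"
    using that assms
    by (simp add: pure_tensor_def tensor_add_class tensor_class_eq_iff upd closed free_space_closed
        tensor_relations.additive)
  show "pure_tensor K I V (x(i := c \<odot>\<^bsub>V i\<^esub> a))
      = c \<odot>\<^bsub>tensor_product K I V\<^esub> pure_tensor K I V (x(i := a))"
    if "c \<in> K" "a \<in> carrier (V i)"
    using that assms tensor_relations.homogeneous[of x I V i c K a]
    by (simp add: pure_tensor_def tensor_smult_class tensor_class_eq_iff upd closed free_space_closed)
qed

lemma free_map_superset: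
  assumes "finite A" "Poly_Mapping.keys p \<subseteq> A"
  shows "free_map I f p =
    (\<Sum>x\<in>A. Poly_Mapping.single (\<lambda>i\<in>I. f i (x i)) (Poly_Mapping.lookup p x))"
  unfolding free_map_def using assms by (intro sum.mono_neutral_left) (auto simp: in_keys_iff)

lemma free_map_add: "free_map I f (p + q) = free_map I f p + free_map I f q"
proof -
  let ?A = "Poly_Mapping.keys p \<union> Poly_Mapping.keys q"
  show ?thesis
    using keys_add[of p q]
    by (subst (1 2 3) free_map_superset[of ?A])
      (auto simp: lookup_add single_add sum.distrib)
qed

lemma free_map_scale:
  "free_map I f (Poly_Mapping.map ((*) c) p) = Poly_Mapping.map ((*) c) (free_map I f p)"
proof (rule poly_mapping_eqI)
  fix y
  show "Poly_Mapping.lookup (free_map I f (Poly_Mapping.map ((*) c) p)) y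
      = Poly_Mapping.lookup (Poly_Mapping.map ((*) c) (free_map I f p)) y"
    by (subst free_map_superset[OF finite_keys keys_scale])
      (simp add: free_map_def lookup_sum lookup_single sum_distrib_left mult_when)
qed

lemma free_map_minus: "free_map I f (p - q) = free_map I f p - free_map I f q"
  using free_map_add[of I f "p - q" q] by (simp add: algebra_simps)

lemma free_map_single:
  "free_map I f (Poly_Mapping.single x c) = Poly_Mapping.single (\<lambda>i\<in>I. f i (x i)) c"
  by (subst free_map_superset[of "{x}"]) auto

lemma free_map_closed:
  assumes f: "\<And>i. i \<in> I \<Longrightarrow> f i \<in> linear_maps K (V i) (W i)"
    and p: "p \<in> free_space K (\<Pi>\<^sub>E i\<in>I. carrier (V i))"
  shows "free_map I f p \<in> free_space K (\<Pi>\<^sub>E i\<in>I. carrier (W i))"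
proof -
  let ?G = "free_space K (\<Pi>\<^sub>E i\<in>I. carrier (W i))"
  have "(\<Sum>x\<in>A. Poly_Mapping.single (\<lambda>i\<in>I. f i (x i)) (Poly_Mapping.lookup p x)) \<in> ?G"
    if "finite A" "A \<subseteq> Poly_Mapping.keys p" for A
    using that
  proof (induction A rule: finite_induct)
    case (insert x A)
    then have "x \<in> (\<Pi>\<^sub>E i\<in>I. carrier (V i))" "Poly_Mapping.lookup p x \<in> K"
      using p by (auto simp: free_space_def)
    then have "Poly_Mapping.single (\<lambda>i\<in>I. f i (x i)) (Poly_Mapping.lookup p x) \<in> ?G"
      using f by (intro free_space_closed) (auto simp: linear_maps_def Pi_iff PiE_iff)
    with insert show ?case by (simp add: free_space_closed del: restrict_apply)
  qed (simp add: free_space_closed)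
  from this[of "Poly_Mapping.keys p"] show ?thesis
    by (simp add: free_map_def)
qed

lemma free_map_relations:
  assumes f: "\<And>i. i \<in> I \<Longrightarrow> f i \<in> linear_maps K (V i) (W i)"
    and p: "p \<in> tensor_relations K I V"
  shows "free_map I f p \<in> tensor_relations K I W"
  using p
proof (induction rule: tensor_relations.induct)
  case zero
  then show ?case by (simp add: free_map_def tensor_relations.zero)
next
  case (plus p q)
  then show ?case by (simp add: free_map_add tensor_relations.plus)
next
  case (scale c p)
  then show ?case by (simp add: free_map_scale tensor_relations.scale)
next
  case (additive x i a b)
  have upd: "(\<lambda>j\<in>I. f j ((x(i := d)) j)) = (\<lambda>j\<in>I. f j (x j))(i := f i d)" for d
    using additive(2) by (auto simp: fun_eq_iff)
  have "(\<lambda>j\<in>I. f j (x j)) \<in> (\<Pi>\<^sub>E i\<in>I. carrier (W i))" "f i a \<in> carrier (W i)" "f i b \<in> carrier (W i)"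
    "f i (a \<oplus>\<^bsub>V i\<^esub> b) = f i a \<oplus>\<^bsub>W i\<^esub> f i b"
    using f additive by (auto simp: linear_maps_def Pi_iff PiE_iff)
  with additive(2) show ?case
    by (simp only: free_map_minus free_map_add free_map_single upd tensor_relations.additive)
next
  case (homogeneous x i c a)
  have upd: "(\<lambda>j\<in>I. f j ((x(i := d)) j)) = (\<lambda>j\<in>I. f j (x j))(i := f i d)" for d
    using homogeneous(2) by (auto simp: fun_eq_iff)
  have "(\<lambda>j\<in>I. f j (x j)) \<in> (\<Pi>\<^sub>E i\<in>I. carrier (W i))" "f i a \<in> carrier (W i)"
    "f i (c \<odot>\<^bsub>V i\<^esub> a) = c \<odot>\<^bsub>W i\<^esub> f i a"
    using f homogeneous by (auto simp: linear_maps_def Pi_iff PiE_iff)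
  with homogeneous(2,3) show ?case
    by (simp only: free_map_minus free_map_single upd tensor_relations.homogeneous)
qed

lemma tensor_map_class:
  assumes f: "\<And>i. i \<in> I \<Longrightarrow> f i \<in> linear_maps K (V i) (W i)"
    and p: "p \<in> free_space K (\<Pi>\<^sub>E i\<in>I. carrier (V i))"
  shows "tensor_map K I V W f (tensor_eq K I V `` {p}) = tensor_eq K I W `` {free_map I f p}"
proof -
  have "congruent (tensor_eq K I V) (\<lambda>p. tensor_eq K I W `` {free_map I f p})"
    using free_map_relations[OF f] free_map_closed[OF f]
    by (intro congruentI, subst tensor_class_eq_iff)
      (auto simp: tensor_eq_def simp flip: free_map_minus)
  from UN_equiv_class[OF equiv_tensor_eq this p] show ?thesis
    by (simp add: tensor_map_def)
qed

theorem tensor_map_linear: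
  assumes f: "\<And>i. i \<in> I \<Longrightarrow> f i \<in> linear_maps K (V i) (W i)"
  shows "tensor_map K I V W f \<in> linear_maps K (tensor_product K I V) (tensor_product K I W)"
  unfolding linear_maps_def
  by (auto elim!: tensor_product_cases
      simp: tensor_map_class[OF f] free_map_closed[OF f] tensor_class_closed tensor_add_class
        tensor_smult_class free_space_closed free_map_add free_map_scale)

theorem tensor_map_pure:
  assumes f: "\<And>i. i \<in> I \<Longrightarrow> f i \<in> linear_maps K (V i) (W i)"
    and x: "x \<in> (\<Pi>\<^sub>E i\<in>I. carrier (V i))"
  shows "tensor_map K I V W f (pure_tensor K I V x) = pure_tensor K I W (\<lambda>i\<in>I. f i (x i))"
  unfolding pure_tensor_def
  by (subst tensor_map_class[OF f]) (simp_all add: x free_space_closed closed free_map_single)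

end

end

theory Submission
  imports Defs
begin

text \<open>
  Suppose \<open>L = (L\<^sub>1, \<dots>, L\<^sub>k)\<close> carries \<open>B\<close> to \<open>B'\<close> in the big tensor product. Put
  \<open>W\<^sub>i = U\<^sub>i \<inter> L\<^sub>i\<^sup>-\<^sup>1 U\<^sub>i\<close> and choose a linear projection \<open>P\<^sub>i\<close> of \<open>V\<^sub>i\<close> onto \<open>U\<^sub>i\<close> that maps \<open>L\<^sub>i\<^sup>-\<^sup>1 U\<^sub>i\<close> into
  itself. Applying \<open>P\<^sub>1 \<otimes> \<dots> \<otimes> P\<^sub>k\<close> to \<open>B = L\<^sup>-\<^sup>1 B'\<close> writes \<open>B\<close> as a finite sum of tensors with all
  factors in \<open>W\<^sub>i\<close>. It remains to find an element of \<open>GL(U\<^sub>i)\<close>, respectively \<open>O(U\<^sub>i)\<close>, that agrees with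
  \<open>L\<^sub>i\<close> on the finitely many factors that occur: start from the identity and correct one vector at a
  time by a map \<open>x \<mapsto> x + \<phi>(x) d\<close> that fixes the vectors already treated. This needs no dimension
  theory, so the \<open>V\<^sub>i\<close> may be infinite-dimensional.
\<close>

section \<open>Vector spaces over \<open>K\<close> and their subspaces\<close>

locale kspace =
  fixes K :: "complex set" and V :: "(complex, 'v) module" (structure)
  assumes K: "K = \<real> \<or> K = UNIV" and is_module: "module (scalars K) V"
begin

sublocale module "scalars K" V
  by (rule is_module)

lemma K_closed [simp]:
  "0 \<in> K" "1 \<in> K" "a \<in> K \<Longrightarrow> b \<in> K \<Longrightarrow> a + b \<in> K" "a \<in> K \<Longrightarrow> b \<in> K \<Longrightarrow> a * b \<in> K"
  "a \<in> K \<Longrightarrow> - a \<in> K" "a \<in> K \<Longrightarrow> b \<in> K \<Longrightarrow> a - b \<in> K" "a \<in> K \<Longrightarrow> inverse a \<in> K"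
  "a \<in> K \<Longrightarrow> b \<in> K \<Longrightarrow> a / b \<in> K"
  using K by auto

lemma scale_closed [simp]: "a \<in> K \<Longrightarrow> x \<in> carrier V \<Longrightarrow> a \<odot> x \<in> carrier V"
  using smult_closed by simp

lemma scale_simps [simp]:
  "x \<in> carrier V \<Longrightarrow> 0 \<odot> x = \<zero>" "a \<in> K \<Longrightarrow> a \<odot> \<zero> = \<zero>" "x \<in> carrier V \<Longrightarrow> 1 \<odot> x = x"
  using smult_l_null smult_r_null smult_one by simp_all

lemma scale_distr:
  "a \<in> K \<Longrightarrow> b \<in> K \<Longrightarrow> x \<in> carrier V \<Longrightarrow> (a + b) \<odot> x = a \<odot> x \<oplus> b \<odot> x"
  "a \<in> K \<Longrightarrow> x \<in> carrier V \<Longrightarrow> y \<in> carrier V \<Longrightarrow> a \<odot> (x \<oplus> y) = a \<odot> x \<oplus> a \<odot> y"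
  "a \<in> K \<Longrightarrow> b \<in> K \<Longrightarrow> x \<in> carrier V \<Longrightarrow> a \<odot> (b \<odot> x) = (a * b) \<odot> x"
  using smult_l_distr smult_r_distr smult_assoc1 by simp_all

lemma a_inv_scale: "x \<in> carrier V \<Longrightarrow> \<ominus> x = (- 1) \<odot> x"
  using scale_distr(1)[of 1 "- 1" x] by (intro M.minus_equality) (simp_all add: M.a_comm)

lemma subspaceI:
  assumes "H \<subseteq> carrier V" "\<zero> \<in> H" "\<And>x y. x \<in> H \<Longrightarrow> y \<in> H \<Longrightarrow> x \<oplus> y \<in> H"
    and "\<And>a x. a \<in> K \<Longrightarrow> x \<in> H \<Longrightarrow> a \<odot> x \<in> H"
  shows "submodule H (scalars K) V"
  using assms a_inv_scale by (intro submoduleI) (auto simp: subset_iff)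

lemma subspaceD:
  assumes "submodule H (scalars K) V"
  shows "x \<in> H \<Longrightarrow> x \<in> carrier V" "\<zero> \<in> H" "x \<in> H \<Longrightarrow> y \<in> H \<Longrightarrow> x \<oplus> y \<in> H"
    "a \<in> K \<Longrightarrow> x \<in> H \<Longrightarrow> a \<odot> x \<in> H" "x \<in> H \<Longrightarrow> \<ominus> x \<in> H" "x \<in> H \<Longrightarrow> y \<in> H \<Longrightarrow> x \<ominus> y \<in> H"
  using submoduleE[OF assms] subgroup.one_closed[OF submodule.axioms(1)[OF assms]]
  by (auto simp: subset_iff a_minus_def)

lemma kspace_subspace: "submodule H (scalars K) V \<Longrightarrow> kspace K (subspace_of V H)"
  unfolding kspace_def subspace_of_def using K is_module submodule.submodule_is_module by blast

section \<open>Sums of subspaces, complements and projections\<close>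

lemma subspace_sum:
  assumes A: "submodule A (scalars K) V" and B: "submodule B (scalars K) V"
  shows "submodule {x \<oplus> y | x y. x \<in> A \<and> y \<in> B} (scalars K) V" (is "submodule ?S _ _")
proof (rule subspaceI)
  note A = subspaceD[OF A] and B = subspaceD[OF B]
  show "?S \<subseteq> carrier V" using A(1) B(1) by auto
  show "\<zero> \<in> ?S" using A(2) B(2) by force
  show "s \<oplus> t \<in> ?S" if st: "s \<in> ?S" "t \<in> ?S" for s t
  proof -
    from st obtain x y x' y' where h: "x \<in> A" "y \<in> B" "x' \<in> A" "y' \<in> B" "s = x \<oplus> y" "t = x' \<oplus> y'"
      by blast
    then have "s \<oplus> t = (x \<oplus> x') \<oplus> (y \<oplus> y')"
      using A(1) B(1) by (simp add: M.a_ac)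
    with h A(3) B(3) show ?thesis by blast
  qed
  show "a \<odot> s \<in> ?S" if as: "a \<in> K" "s \<in> ?S" for a s
  proof -
    from as obtain x y where h: "x \<in> A" "y \<in> B" "s = x \<oplus> y"
      by blast
    then have "a \<odot> s = a \<odot> x \<oplus> a \<odot> y"
      using A(1) B(1) as by (simp add: scale_distr)
    with h A(4) B(4) as show ?thesis by blast
  qed
qed

lemma subspace_line:
  assumes "u \<in> carrier V"
  shows "submodule {a \<odot> u | a. a \<in> K} (scalars K) V" (is "submodule ?S _ _")
proof (rule subspaceI)
  show "\<zero> \<in> ?S" using assms by (force intro: exI[of _ 0])
  show "s \<oplus> t \<in> ?S" if "s \<in> ?S" "t \<in> ?S" for s t
    using that assms by (auto simp flip: scale_distr(1) intro: exI[of _ "_ + _"])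
  show "a \<odot> s \<in> ?S" if "a \<in> K" "s \<in> ?S" for a s
    using that assms by (auto simp: scale_distr(3))
qed (use assms in auto)

text \<open>Zorn's lemma for the subspaces between \<open>A\<close> and \<open>T\<close> that meet
  \<open>U\<close> trivially: the sum of \<open>U\<close> and a maximal one contains
  \<open>T\<close>, because otherwise a further vector of \<open>T\<close> could be adjoined. The
  bounds \<open>A\<close> and \<open>T\<close> allow two uses: a complement containing a prescribed
  subspace, and one inside a prescribed subspace.\<close>

lemma complement_exists:
  assumes U: "submodule U (scalars K) V" and A: "submodule A (scalars K) V"
    and T: "submodule T (scalars K) V" and AT: "A \<subseteq> T" and AU: "A \<inter> U \<subseteq> {\<zero>}"
  obtains C where "submodule C (scalars K) V" "A \<subseteq> C" "C \<subseteq> T" "C \<inter> U \<subseteq> {\<zero>}"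
    "\<And>t. t \<in> T \<Longrightarrow> \<exists>u\<in>U. \<exists>c\<in>C. t = u \<oplus> c"
proof -
  define \<A> where "\<A> = {C. submodule C (scalars K) V \<and> A \<subseteq> C \<and> C \<subseteq> T \<and> C \<inter> U \<subseteq> {\<zero>}}"
  have "\<exists>C\<in>\<A>. \<forall>X\<in>\<A>. C \<subseteq> X \<longrightarrow> X = C"
  proof (rule subset_Zorn_nonempty)
    show "\<A> \<noteq> {}" using A AT AU by (auto simp: \<A>_def)
    fix \<C> assume ne: "\<C> \<noteq> {}" and ch: "subset.chain \<A> \<C>"
    have sub: "submodule C (scalars K) V" if "C \<in> \<C>" for C
      using that ch by (auto simp: subset.chain_def \<A>_def)
    have "submodule (\<Union>\<C>) (scalars K) V"
    proof (rule subspaceI)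
      show "\<Union>\<C> \<subseteq> carrier V" using subspaceD(1)[OF sub] by blast
      show "\<zero> \<in> \<Union>\<C>" using ne subspaceD(2)[OF sub] by blast
      show "x \<oplus> y \<in> \<Union>\<C>" if xy: "x \<in> \<Union>\<C>" "y \<in> \<Union>\<C>" for x y
      proof -
        from xy obtain C D where CD: "C \<in> \<C>" "D \<in> \<C>" "x \<in> C" "y \<in> D" by blast
        with ch have "C \<subseteq> D \<or> D \<subseteq> C" unfolding subset.chain_def by blast
        with CD subspaceD(3)[OF sub] show ?thesis by blast
      qed
      show "a \<odot> x \<in> \<Union>\<C>" if "a \<in> K" "x \<in> \<Union>\<C>" for a x
        using that subspaceD(4)[OF sub] by blast
    qed
    moreover have "A \<subseteq> \<Union>\<C>" "\<Union>\<C> \<subseteq> T" "\<Union>\<C> \<inter> U \<subseteq> {\<zero>}"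
    proof -
      have "\<And>C. C \<in> \<C> \<Longrightarrow> A \<subseteq> C \<and> C \<subseteq> T \<and> C \<inter> U \<subseteq> {\<zero>}"
        using ch by (auto simp: subset.chain_def \<A>_def)
      with ne show "A \<subseteq> \<Union>\<C>" "\<Union>\<C> \<subseteq> T" "\<Union>\<C> \<inter> U \<subseteq> {\<zero>}" by blast+
    qed
    ultimately show "\<Union>\<C> \<in> \<A>" by (simp add: \<A>_def)
  qed
  then obtain C where C: "C \<in> \<A>" and max: "\<And>X. X \<in> \<A> \<Longrightarrow> C \<subseteq> X \<Longrightarrow> X = C" by blast
  have sC: "submodule C (scalars K) V" and CA: "A \<subseteq> C" "C \<subseteq> T" "C \<inter> U \<subseteq> {\<zero>}"
    using C by (auto simp: \<A>_def)
  note Cd = subspaceD[OF sC] and Ud = subspaceD[OF U] and Td = subspaceD[OF T]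
  have "\<exists>u\<in>U. \<exists>c\<in>C. t = u \<oplus> c" if t: "t \<in> T" for t
  proof (rule ccontr)
    assume neg: "\<not> ?thesis"
    have tV: "t \<in> carrier V" using t Td by blast
    \<comment> \<open>\<open>C\<close> enlarged by the line through \<open>t\<close>; it contradicts
      the maximality of \<open>C\<close> once it is shown to meet \<open>U\<close>
      trivially.\<close>
    let ?X = "{x \<oplus> y | x y. x \<in> C \<and> y \<in> {a \<odot> t | a. a \<in> K}}"
    have X: "submodule ?X (scalars K) V"
      by (intro subspace_sum sC subspace_line tV)
    have CX: "C \<subseteq> ?X"
    proof
      fix c assume "c \<in> C"
      then have "c = c \<oplus> 0 \<odot> t" using Cd(1) tV by simp
      with \<open>c \<in> C\<close> show "c \<in> ?X" by force
    qed
    have XT: "?X \<subseteq> T" using CA(2) t Td by blast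
    have "?X \<inter> U \<subseteq> {\<zero>}"
    proof
      fix u assume "u \<in> ?X \<inter> U"
      then obtain c a where h: "c \<in> C" "a \<in> K" "u = c \<oplus> a \<odot> t" "u \<in> U" by blast
      have V: "c \<in> carrier V" "u \<in> carrier V" using h Cd Ud by auto
      show "u \<in> {\<zero>}"
      proof (cases "a = 0")
        case True
        then show ?thesis using h V tV CA(3) by auto
      next
        case False
        \<comment> \<open>Dividing \<open>u = c + a t\<close> by \<open>a\<close> puts
          \<open>t\<close> into \<open>U + C\<close>, against \<open>neg\<close>.\<close>
        have "a \<odot> t = \<ominus> c \<oplus> (c \<oplus> a \<odot> t)"
          using h V tV by (simp add: M.r_neg1)
        then have "a \<odot> t = u \<oplus> \<ominus> c"
          using h V by (simp add: M.a_comm)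
        then have "inverse a \<odot> (a \<odot> t) = inverse a \<odot> (u \<oplus> \<ominus> c)"
          by (simp only:)
        also have "\<dots> = inverse a \<odot> u \<oplus> inverse a \<odot> (\<ominus> c)"
          using h(2) V by (simp add: scale_distr)
        finally have "inverse a \<odot> (a \<odot> t) = inverse a \<odot> u \<oplus> inverse a \<odot> (\<ominus> c)" .
        then have "t = inverse a \<odot> u \<oplus> inverse a \<odot> (\<ominus> c)"
          using h(2) V tV False by (simp add: scale_distr(3))
        then show ?thesis
          using neg h Ud(4)[of "inverse a" u] Cd(4)[of "inverse a" "\<ominus> c"] Cd(5)[of c] K_closed(7)[of a] by blast
      qed
    qed
    then have "?X \<in> \<A>" using X CX XT CA(1) by (auto simp: \<A>_def)
    \<comment> \<open>By maximality \<open>t\<close> lies in \<open>C\<close> itself, so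
      \<open>t = 0 + t\<close> is a forbidden decomposition.\<close>
    then have XC: "?X = C" using max CX by blast
    have "t = \<zero> \<oplus> 1 \<odot> t" using tV by simp
    then have "t \<in> ?X" using Cd(2) K_closed(2) by blast
    then have "t \<in> C" by (simp only: XC)
    moreover have "t = \<zero> \<oplus> t" using tV by simp
    ultimately show False using neg Ud(2) by blast
  qed
  with that sC CA show ?thesis by blast
qed

text \<open>Take a complement of \<open>U\<close> that contains \<open>S\<close> and project along
  it.\<close>

lemma projection_exists:
  assumes U: "submodule U (scalars K) V" and S: "submodule S (scalars K) V" and SU: "S \<inter> U \<subseteq> {\<zero>}"
  obtains P where "P \<in> linear_maps K V (subspace_of V U)"
    "\<And>x. x \<in> U \<Longrightarrow> P x = x" "\<And>x. x \<in> S \<Longrightarrow> P x = \<zero>"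
proof -
  obtain C where C: "submodule C (scalars K) V" "S \<subseteq> C" "C \<inter> U \<subseteq> {\<zero>}"
    and dec: "\<And>t. t \<in> carrier V \<Longrightarrow> \<exists>u\<in>U. \<exists>c\<in>C. t = u \<oplus> c"
    using complement_exists[OF U S carrier_is_submodule _ SU] submoduleE(1)[OF S] by metis
  note Cd = subspaceD[OF C(1)] and Ud = subspaceD[OF U]
  define P where "P t = (SOME u. u \<in> U \<and> (\<exists>c\<in>C. t = u \<oplus> c))" for t
  have P: "P (u \<oplus> c) = u" if uc: "u \<in> U" "c \<in> C" for u c
  proof -
    \<comment> \<open>Uniqueness of the \<open>U\<close>-component: the difference of two of them
      equals a difference of elements of \<open>C\<close>, hence lies in
      \<open>C \<inter> U\<close>.\<close>
    have "v = u" if v: "v \<in> U" "d \<in> C" "u \<oplus> c = v \<oplus> d" for v d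
    proof -
      have V: "u \<in> carrier V" "c \<in> carrier V" "v \<in> carrier V" "d \<in> carrier V"
        using uc v Cd Ud by auto
      have "v = (v \<oplus> d) \<ominus> d" using V by (simp add: a_minus_def M.a_assoc M.r_neg)
      also have "\<dots> = (u \<oplus> c) \<ominus> d" using v by simp
      also have "\<dots> = u \<oplus> (c \<ominus> d)" using V by (simp add: a_minus_def M.a_assoc)
      finally have eq: "v = u \<oplus> (c \<ominus> d)" .
      then have "v \<ominus> u = \<ominus> u \<oplus> (u \<oplus> (c \<ominus> d))"
        using V by (simp add: a_minus_def M.a_comm)
      then have "v \<ominus> u = c \<ominus> d" using V by (simp add: M.r_neg1)
      moreover have "v \<ominus> u \<in> U" "c \<ominus> d \<in> C" using uc v Cd Ud by auto
      ultimately have "c \<ominus> d = \<zero>" using C(3) by auto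
      then show ?thesis using V eq by simp
    qed
    then show ?thesis unfolding P_def using uc by (intro some_equality) blast+
  qed
  show ?thesis
  proof (rule that)
    show "P x = x" if "x \<in> U" for x
      using P[of x \<zero>] that Ud Cd by simp
    show "P x = \<zero>" if "x \<in> S" for x
      using P[of \<zero> x] that Ud Cd C by auto
    show "P \<in> linear_maps K V (subspace_of V U)"
      unfolding linear_maps_def subspace_of_def
    proof (clarsimp, intro conjI ballI)
      show "P \<in> carrier V \<rightarrow> U" using dec P by fastforce
      fix x y assume "x \<in> carrier V" "y \<in> carrier V"
      then obtain u c v d where h: "u \<in> U" "c \<in> C" "v \<in> U" "d \<in> C" "x = u \<oplus> c" "y = v \<oplus> d"
        using dec by meson
      then have "x \<oplus> y = (u \<oplus> v) \<oplus> (c \<oplus> d)"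
        using Ud Cd by (simp add: M.a_ac)
      then show "P (x \<oplus> y) = P x \<oplus> P y" using P h Ud(3) Cd(3) by simp
    next
      fix a x assume a: "a \<in> K" and "x \<in> carrier V"
      then obtain u c where h: "u \<in> U" "c \<in> C" "x = u \<oplus> c"
        using dec by meson
      then have "a \<odot> x = a \<odot> u \<oplus> a \<odot> c"
        using Ud Cd a by (simp add: scale_distr)
      then show "P (a \<odot> x) = a \<odot> P x" using P h Ud(4) Cd(4) a by simp
    qed
  qed
qed

text \<open>The kernel of the projection is made to contain a subspace \<open>A\<close> of
  \<open>U'\<close> that meets \<open>U\<close> trivially and satisfies
  \<open>U' \<subseteq> U + A\<close>. For \<open>x = u + c\<close> in \<open>U'\<close> the value
  is then \<open>u = x - c\<close>, again in \<open>U'\<close>.\<close>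

lemma adapted_projection_exists:
  assumes U: "submodule U (scalars K) V" and U': "submodule U' (scalars K) V"
  obtains P where "P \<in> linear_maps K V (subspace_of V U)"
    "\<And>x. x \<in> U \<Longrightarrow> P x = x" "\<And>x. x \<in> U' \<Longrightarrow> P x \<in> U'"
proof -
  note Ud = subspaceD[OF U] and U'd = subspaceD[OF U']
  have "submodule {\<zero>} (scalars K) V" by (rule subspaceI) auto
  then obtain A where A: "submodule A (scalars K) V" "A \<subseteq> U'" "A \<inter> U \<subseteq> {\<zero>}"
    and dec: "\<And>t. t \<in> U' \<Longrightarrow> \<exists>u\<in>U. \<exists>c\<in>A. t = u \<oplus> c"
    using complement_exists[OF U _ U', of "{\<zero>}"] U'd(2) by (metis empty_subsetI insert_subset inf_le1)
  obtain P where P: "P \<in> linear_maps K V (subspace_of V U)"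
    "\<And>x. x \<in> U \<Longrightarrow> P x = x" "\<And>x. x \<in> A \<Longrightarrow> P x = \<zero>"
    using projection_exists[OF U A(1,3)] by blast
  have "P x \<in> U'" if x: "x \<in> U'" for x
  proof -
    obtain u c where h: "u \<in> U" "c \<in> A" "x = u \<oplus> c" using dec x by blast
    then have V: "u \<in> carrier V" "c \<in> carrier V" "c \<in> U'" using Ud A U'd by auto
    then have "P x = u" using P h Ud by (simp add: linear_maps_def subspace_of_def)
    also have "u = x \<ominus> c" using h V by (simp add: a_minus_def M.a_assoc M.r_neg)
    finally show ?thesis using U'd x V by simp
  qed
  with P that show ?thesis by blast
qed

section \<open>Linear functionals\<close>

definition functionals :: "('v \<Rightarrow> complex) set"
  where "functionals = {\<phi> \<in> carrier V \<rightarrow> K.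
    (\<forall>x\<in>carrier V. \<forall>y\<in>carrier V. \<phi> (x \<oplus> y) = \<phi> x + \<phi> y) \<and>
    (\<forall>a\<in>K. \<forall>x\<in>carrier V. \<phi> (a \<odot> x) = a * \<phi> x)}"

text \<open>Project onto the line through \<open>u\<close> along a complement containing
  \<open>S\<close> and read off the coefficient.\<close>

lemma functional_exists:
  assumes S: "submodule S (scalars K) V" and u: "u \<in> carrier V" "u \<notin> S"
  obtains \<phi> where "\<phi> \<in> functionals" "\<And>x. x \<in> S \<Longrightarrow> \<phi> x = 0" "\<phi> u = 1"
proof -
  note Sd = subspaceD[OF S]
  let ?L = "{a \<odot> u | a. a \<in> K}"
  \<comment> \<open>\<open>u\<close> is nonzero because \<open>S\<close> contains zero, so
    coefficients along the line are unique and the choice in \<open>\<phi>\<close> below is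
    determined.\<close>
  have inj: "a = b" if "a \<in> K" "b \<in> K" "a \<odot> u = b \<odot> u" for a b
  proof (rule ccontr)
    assume "a \<noteq> b"
    have "(a - b) \<odot> u = \<zero>"
      using scale_distr(1)[of a "- b" u] scale_distr(1)[of b "- b" u] that u by simp
    then have "inverse (a - b) \<odot> ((a - b) \<odot> u) = \<zero>" using that by simp
    then have "u = \<zero>" using that u \<open>a \<noteq> b\<close> by (simp add: scale_distr(3) del: right_diff_distrib)
    then show False using u Sd by simp
  qed
  have "S \<inter> ?L \<subseteq> {\<zero>}"
  proof
    fix x assume "x \<in> S \<inter> ?L"
    then obtain a where a: "a \<in> K" "x = a \<odot> u" "x \<in> S" by blast
    show "x \<in> {\<zero>}"
    proof (cases "a = 0")
      case False
      have "inverse a \<odot> x = u" using a u False by (simp add: scale_distr(3))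
      then show ?thesis using Sd(4)[of "inverse a" x] a u by simp
    qed (use a u in simp)
  qed
  then obtain P where P: "P \<in> linear_maps K V (subspace_of V ?L)"
    "\<And>x. x \<in> ?L \<Longrightarrow> P x = x" "\<And>x. x \<in> S \<Longrightarrow> P x = \<zero>"
    using projection_exists[OF subspace_line[OF u(1)] S] by blast
  define \<phi> where "\<phi> x = (SOME a. a \<in> K \<and> P x = a \<odot> u)" for x
  have \<phi>: "\<phi> x = a" if "a \<in> K" "P x = a \<odot> u" for x a
    unfolding \<phi>_def using that inj by (intro some_equality) auto
  have ex: "\<exists>a\<in>K. P x = a \<odot> u" if "x \<in> carrier V" for x
    using that P(1) by (auto simp: linear_maps_def subspace_of_def)
  show ?thesis
  proof (rule that)
    show "\<phi> x = 0" if "x \<in> S" for x using \<phi>[of 0 x] P(3) that u by simp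
    show "\<phi> u = 1" using \<phi>[of 1 u] P(2)[of u] u by (metis (mono_tags, lifting) K_closed(2) mem_Collect_eq scale_simps(3))
    show "\<phi> \<in> functionals"
      unfolding functionals_def
    proof (clarsimp, intro conjI ballI)
      show "\<phi> \<in> carrier V \<rightarrow> K" using ex \<phi> by fastforce
      fix x y assume xy: "x \<in> carrier V" "y \<in> carrier V"
      then obtain a b where h: "a \<in> K" "b \<in> K" "P x = a \<odot> u" "P y = b \<odot> u" using ex by meson
      then have "P (x \<oplus> y) = (a + b) \<odot> u"
        using P(1) xy u by (simp add: linear_maps_def subspace_of_def scale_distr)
      then show "\<phi> (x \<oplus> y) = \<phi> x + \<phi> y" using \<phi> h by simp
    next
      fix a x assume ax: "a \<in> K" "x \<in> carrier V"
      then obtain b where h: "b \<in> K" "P x = b \<odot> u" using ex by meson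
      then have "P (a \<odot> x) = (a * b) \<odot> u"
        using P(1) ax u by (simp add: linear_maps_def subspace_of_def scale_distr)
      then show "\<phi> (a \<odot> x) = a * \<phi> x" using \<phi> h ax by simp
    qed
  qed
qed

end

section \<open>The general linear group, transvections and extension from finite sets\<close>

lemma GL_iff:
  "f \<in> carrier (GL_group K V) \<longleftrightarrow>
    f \<in> extensional (carrier V) \<and> bij_betw f (carrier V) (carrier V) \<and> f \<in> linear_maps K V V"
  by (auto simp: GL_group_def Bij_def)

lemma GL_mult:
  "f \<in> carrier (GL_group K V) \<Longrightarrow> g \<in> carrier (GL_group K V) \<Longrightarrow>
    f \<otimes>\<^bsub>GL_group K V\<^esub> g = compose (carrier V) f g"
  by (simp add: GL_group_def BijGroup_def)

lemma GL_one: "\<one>\<^bsub>GL_group K V\<^esub> = (\<lambda>x\<in>carrier V. x)"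
  by (simp add: GL_group_def BijGroup_def)

context kspace
begin

lemma subgroup_GL: "subgroup (carrier (GL_group K V)) (BijGroup (carrier V))"
proof (rule group.subgroupI[OF group_BijGroup])
  show "carrier (GL_group K V) \<subseteq> carrier (BijGroup (carrier V))"
    by (auto simp: GL_group_def BijGroup_def)
  have "(\<lambda>x\<in>carrier V. x) \<in> carrier (GL_group K V)"
    by (simp add: GL_group_def linear_maps_def id_Bij)
  then show "carrier (GL_group K V) \<noteq> {}" by blast
next
  fix f assume f: "f \<in> carrier (GL_group K V)"
  then have B: "f \<in> Bij (carrier V)" and l: "f \<in> linear_maps K V V"
    by (auto simp: GL_group_def)
  let ?g = "\<lambda>x\<in>carrier V. inv_into (carrier V) f x"
  have "inv_into (carrier V) f (x \<oplus> y) = inv_into (carrier V) f x \<oplus> inv_into (carrier V) f y"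
    if "x \<in> carrier V" "y \<in> carrier V" for x y
    using that l B by (intro Bij_inv_into_lemma) (auto simp: linear_maps_def)
  moreover have "inv_into (carrier V) f (a \<odot> x) = a \<odot> inv_into (carrier V) f x"
    if "a \<in> K" "x \<in> carrier V" for a x
  proof -
    have i: "inv_into (carrier V) f x \<in> carrier V" "f (inv_into (carrier V) f x) = x"
      using B that by (auto simp: Bij_inv_into_mem Bij_def bij_betw_inv_into_right)
    then have "f (a \<odot> inv_into (carrier V) f x) = a \<odot> x"
      using that l by (simp add: linear_maps_def)
    moreover have "inj_on f (carrier V)" using B by (simp add: Bij_def bij_betw_def)
    ultimately show ?thesis using that i by (metis inv_into_f_f scale_closed)
  qed
  ultimately have "?g \<in> linear_maps K V V"
    using Bij_inv_into_mem[OF B] by (simp add: linear_maps_def Pi_iff)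
  with B show "inv\<^bsub>BijGroup (carrier V)\<^esub> f \<in> carrier (GL_group K V)"
    by (simp add: inv_BijGroup restrict_inv_into_Bij GL_group_def)
next
  fix f g assume "f \<in> carrier (GL_group K V)" "g \<in> carrier (GL_group K V)"
  moreover from this have "compose (carrier V) f g \<in> linear_maps K V V"
    by (auto simp: GL_iff linear_maps_def compose_def Pi_iff)
  ultimately show "f \<otimes>\<^bsub>BijGroup (carrier V)\<^esub> g \<in> carrier (GL_group K V)"
    by (simp add: GL_group_def BijGroup_def compose_Bij)
qed

lemma group_GL: "group (GL_group K V)"
  using subgroup.subgroup_is_group[OF subgroup_GL group_BijGroup] by (simp add: GL_group_def)

lemma GL_inv:
  assumes "f \<in> carrier (GL_group K V)"
  shows "inv\<^bsub>GL_group K V\<^esub> f = (\<lambda>x\<in>carrier V. inv_into (carrier V) f x)"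
proof -
  have "inv\<^bsub>GL_group K V\<^esub> f = inv\<^bsub>BijGroup (carrier V)\<^esub> f"
    using group.m_inv_consistent[OF group_BijGroup subgroup_GL assms] by (simp add: GL_group_def)
  then show ?thesis using assms by (simp add: inv_BijGroup GL_group_def)
qed

lemma GL_inv_apply:
  assumes "f \<in> carrier (GL_group K V)" "x \<in> carrier V"
  shows "(inv\<^bsub>GL_group K V\<^esub> f) (f x) = x" "f ((inv\<^bsub>GL_group K V\<^esub> f) x) = x"
proof -
  have b: "bij_betw f (carrier V) (carrier V)" using assms by (simp add: GL_iff)
  then have "f x \<in> carrier V" using assms bij_betwE by blast
  then show "(inv\<^bsub>GL_group K V\<^esub> f) (f x) = x" "f ((inv\<^bsub>GL_group K V\<^esub> f) x) = x"
    using assms b by (simp_all add: GL_inv bij_betw_inv_into_left bij_betw_inv_into_right)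
qed

text \<open>Applying \<open>\<phi>\<close> to \<open>y = x + \<phi>(x) d\<close> gives
  \<open>\<phi>(y) = (1 + \<phi>(d)) \<phi>(x)\<close>; solving for \<open>x\<close> yields the
  explicit inverse \<open>?S\<close>. Since \<open>\<phi> d\<close> may be nonzero, this covers
  dilations and reflections as well as transvections proper.\<close>

lemma transvection_GL:
  assumes \<phi>: "\<phi> \<in> functionals" and d: "d \<in> carrier V" and nz: "1 + \<phi> d \<noteq> 0"
  shows "(\<lambda>x\<in>carrier V. x \<oplus> \<phi> x \<odot> d) \<in> carrier (GL_group K V)" (is "?T \<in> _")
  unfolding GL_iff
proof (intro conjI)
  have \<phi>K: "\<phi> x \<in> K" if "x \<in> carrier V" for x using \<phi> that by (auto simp: functionals_def)
  have \<phi>add: "\<phi> (x \<oplus> y) = \<phi> x + \<phi> y" if "x \<in> carrier V" "y \<in> carrier V" for x y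
    using \<phi> that by (auto simp: functionals_def)
  have \<phi>scale: "\<phi> (a \<odot> x) = a * \<phi> x" if "a \<in> K" "x \<in> carrier V" for a x
    using \<phi> that by (auto simp: functionals_def)
  let ?S = "\<lambda>x\<in>carrier V. x \<oplus> (- \<phi> x / (1 + \<phi> d)) \<odot> d"
  show "?T \<in> extensional (carrier V)" by simp
  show "?T \<in> linear_maps K V V"
    unfolding linear_maps_def
    using d by (auto simp: \<phi>K \<phi>add \<phi>scale scale_distr M.a_ac)
  have cancel: "(x \<oplus> a \<odot> d) \<oplus> b \<odot> d = x" if "a + b = 0" "a \<in> K" "b \<in> K" "x \<in> carrier V" for x a b
    using that d by (simp add: M.a_assoc flip: scale_distr(1))
  show "bij_betw ?T (carrier V) (carrier V)"
  proof (rule bij_betw_byWitness[where f' = ?S])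
    show "\<forall>x\<in>carrier V. ?S (?T x) = x"
    proof
      fix x assume x: "x \<in> carrier V"
      have "\<phi> (x \<oplus> \<phi> x \<odot> d) = \<phi> x * (1 + \<phi> d)"
        using x d by (simp add: \<phi>add \<phi>scale \<phi>K algebra_simps)
      then have "- \<phi> (x \<oplus> \<phi> x \<odot> d) / (1 + \<phi> d) = - \<phi> x" using nz by simp
      then show "?S (?T x) = x"
        using x d by (simp add: \<phi>K cancel)
    qed
    show "\<forall>x\<in>carrier V. ?T (?S x) = x"
    proof
      fix x assume x: "x \<in> carrier V"
      have K: "- \<phi> x / (1 + \<phi> d) \<in> K" using x d \<phi>K by simp
      have "\<phi> (x \<oplus> (- \<phi> x / (1 + \<phi> d)) \<odot> d) = \<phi> x / (1 + \<phi> d)"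
        using x d K nz by (simp add: \<phi>add \<phi>scale divide_simps) (simp add: algebra_simps)
      then show "?T (?S x) = x"
        using x d K by (simp add: cancel \<phi>K)
    qed
    show "?T ` carrier V \<subseteq> carrier V" "?S ` carrier V \<subseteq> carrier V"
      using d \<phi>K by auto
  qed
qed

text \<open>The induction shared by the linear and the orthogonal case. By \<open>correct\<close>,
  the correction fixes \<open>L x\<close> wherever \<open>g\<close> and \<open>L\<close> already
  agree, so composing it with \<open>g\<close> keeps every value achieved before and adds the one at
  \<open>w\<close>.\<close>

lemma finite_extension:
  assumes G: "subgroup G (GL_group K V)" and S: "finite S" "S \<subseteq> W" and W: "W \<subseteq> carrier V"
    and correct: "\<And>g w. g \<in> G \<Longrightarrow> w \<in> W \<Longrightarrow> g w \<noteq> L w \<Longrightarrow>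
      \<exists>T\<in>G. T (g w) = L w \<and> (\<forall>x\<in>W. g x = L x \<longrightarrow> T (L x) = L x)"
  shows "\<exists>g\<in>G. \<forall>x\<in>S. g x = L x"
  using S
proof (induction S rule: finite_induct)
  case empty
  then show ?case using subgroup.one_closed[OF G] by blast
next
  case (insert w S)
  then obtain g where g: "g \<in> G" "\<forall>x\<in>S. g x = L x" by auto
  show ?case
  proof (cases "g w = L w")
    case False
    then obtain T where T: "T \<in> G" "T (g w) = L w" "\<forall>x\<in>W. g x = L x \<longrightarrow> T (L x) = L x"
      using correct[OF g(1) _ False] insert.prems by auto
    have "T \<otimes>\<^bsub>GL_group K V\<^esub> g \<in> G" using subgroup.m_closed[OF G T(1) g(1)] .
    moreover have "T \<otimes>\<^bsub>GL_group K V\<^esub> g = compose (carrier V) T g"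
      using T(1) g(1) subgroup.subset[OF G] by (intro GL_mult) auto
    ultimately have "compose (carrier V) T g \<in> G" by simp
    moreover have "\<forall>x\<in>insert w S. compose (carrier V) T g x = L x"
      using T g insert.prems W by (auto simp: compose_def subset_iff)
    ultimately show ?thesis by blast
  qed (use g in auto)
qed

text \<open>A map \<open>x + \<phi>(x) d\<close> with \<open>d = v - u\<close> takes
  \<open>u\<close> to \<open>v\<close> if \<open>\<phi> u = 1\<close>, and it is invertible if
  \<open>1 + \<phi> d = \<phi> v\<close> is nonzero. One functional must therefore serve both
  vectors.\<close>

lemma functional_separating_two:
  assumes S: "submodule S (scalars K) V" and u: "u \<in> carrier V" "u \<notin> S" and v: "v \<in> carrier V" "v \<notin> S"
  obtains \<phi> where "\<phi> \<in> functionals" "\<And>x. x \<in> S \<Longrightarrow> \<phi> x = 0" "\<phi> u = 1" "\<phi> v \<noteq> 0"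
proof -
  obtain \<alpha> where a: "\<alpha> \<in> functionals" "\<And>x. x \<in> S \<Longrightarrow> \<alpha> x = 0" "\<alpha> u = 1"
    using functional_exists[OF S u] by blast
  obtain \<beta> where b: "\<beta> \<in> functionals" "\<And>x. x \<in> S \<Longrightarrow> \<beta> x = 0" "\<beta> v = 1"
    using functional_exists[OF S v] by blast
  show ?thesis
  proof (cases "\<alpha> v = 0")
    case False
    with that a show ?thesis by blast
  next
    case av: True
    \<comment> \<open>As \<open>\<alpha> v = 0\<close>, adding a multiple of \<open>\<alpha>\<close>
      to \<open>\<beta>\<close> keeps the value 1 at \<open>v\<close>; this multiple makes the value
      at \<open>u\<close> equal to 1 as well.\<close>
    define c where "c = (1 - \<beta> u)"
    have "\<beta> u \<in> K" using b(1) u(1) by (auto simp: functionals_def)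
    then have c: "c \<in> K" by (simp add: c_def)
    have "(\<lambda>x. c * \<alpha> x + \<beta> x) \<in> functionals"
      using a(1) b(1) c unfolding functionals_def by (auto simp: Pi_iff algebra_simps)
    then show ?thesis using that[of "\<lambda>x. c * \<alpha> x + \<beta> x"] a b av by (simp add: c_def)
  qed
qed

text \<open>For the correction step let \<open>?D\<close> be the space of values of \<open>L\<close>
  at the points where \<open>g\<close> and \<open>L\<close> agree. If they differ at
  \<open>w\<close>, then \<open>g w\<close> is outside \<open>?D\<close> by injectivity of
  \<open>g\<close>, and \<open>L w\<close> by injectivity of \<open>L\<close>. A functional
  vanishing on \<open>?D\<close> then gives a transvection that moves \<open>g w\<close> to
  \<open>L w\<close> and fixes \<open>?D\<close>.\<close>

lemma finite_extension_GL:
  assumes W: "submodule W (scalars K) V" and L: "L \<in> linear_maps K (subspace_of V W) V"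
    and inj: "inj_on L W" and S: "finite S" "S \<subseteq> W"
  shows "\<exists>g\<in>carrier (GL_group K V). \<forall>x\<in>S. g x = L x"
proof (rule finite_extension[OF _ S])
  note Wd = subspaceD[OF W]
  have Lc: "L x \<in> carrier V" if "x \<in> W" for x
    using L that by (auto simp: linear_maps_def subspace_of_def)
  have Ladd: "L (x \<oplus> y) = L x \<oplus> L y" if "x \<in> W" "y \<in> W" for x y
    using L that by (auto simp: linear_maps_def subspace_of_def)
  have Lscale: "L (a \<odot> x) = a \<odot> L x" if "a \<in> K" "x \<in> W" for a x
    using L that by (auto simp: linear_maps_def subspace_of_def)
  show "subgroup (carrier (GL_group K V)) (GL_group K V)"
    using group_GL by (rule group.subgroup_self)
  show "W \<subseteq> carrier V" using Wd by blast
  fix g w assume g: "g \<in> carrier (GL_group K V)" and w: "w \<in> W" and ne: "g w \<noteq> L w"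
  have gl: "g \<in> linear_maps K V V" and gi: "inj_on g (carrier V)"
    using g by (auto simp: GL_iff bij_betw_def)
  let ?D = "L ` {x \<in> W. g x = L x}"
  have D: "submodule ?D (scalars K) V"
  proof (rule subspaceI)
    show "?D \<subseteq> carrier V" using Lc by blast
    have "L \<zero> = \<zero>" using Lscale[of 0 \<zero>] Lc[of \<zero>] Wd(2) by simp
    moreover have "g \<zero> \<in> carrier V" "g (0 \<odot> \<zero>) = 0 \<odot> g \<zero>"
      using gl K_closed(1) M.zero_closed unfolding linear_maps_def by blast+
    then have "g \<zero> = \<zero>" by simp
    ultimately have "g \<zero> = L \<zero>" "\<zero> = L \<zero>" by simp_all
    then show "\<zero> \<in> ?D" using Wd by force
    show "s \<oplus> t \<in> ?D" if st: "s \<in> ?D" "t \<in> ?D" for s t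
    proof -
      from st obtain x y where "x \<in> W" "g x = L x" "y \<in> W" "g y = L y" "s = L x" "t = L y" by blast
      then show ?thesis using Wd gl by (intro image_eqI[of _ _ "x \<oplus> y"]) (auto simp: Ladd linear_maps_def)
    qed
    show "a \<odot> s \<in> ?D" if as: "a \<in> K" "s \<in> ?D" for a s
    proof -
      from as obtain x where "x \<in> W" "g x = L x" "s = L x" by blast
      then show ?thesis using Wd gl as by (intro image_eqI[of _ _ "a \<odot> x"]) (auto simp: Lscale linear_maps_def)
    qed
  qed
  have u: "g w \<in> carrier V" using gl w Wd by (auto simp: linear_maps_def)
  have "g w \<notin> ?D"
  proof
    assume "g w \<in> ?D"
    then obtain x where "x \<in> W" "g x = L x" "g w = g x" by auto
    then show False using gi w Wd ne by (metis inj_onD)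
  qed
  moreover have "L w \<notin> ?D"
    using inj w ne by (auto simp: inj_on_def)
  ultimately obtain \<phi> where \<phi>: "\<phi> \<in> functionals" "\<And>x. x \<in> ?D \<Longrightarrow> \<phi> x = 0" "\<phi> (g w) = 1" "\<phi> (L w) \<noteq> 0"
    using functional_separating_two[OF D u _ Lc[OF w]] by blast
  \<comment> \<open>This is \<open>L w - g w\<close>, so
    \<open>1 + \<phi> ?d = \<phi> (L w)\<close>, which is nonzero by the choice of
    \<open>\<phi>\<close>.\<close>
  let ?d = "(- 1) \<odot> g w \<oplus> L w"
  have d: "?d \<in> carrier V" using u w Lc by simp
  have "\<phi> ?d = - 1 + \<phi> (L w)" using \<phi> u w Lc by (simp add: functionals_def)
  then have "(\<lambda>x\<in>carrier V. x \<oplus> \<phi> x \<odot> ?d) \<in> carrier (GL_group K V)"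
    using \<phi> d by (intro transvection_GL) auto
  moreover have "g w \<oplus> \<phi> (g w) \<odot> ?d = L w"
    using d u w Lc \<phi>(3) by (simp add: M.r_neg1 M.r_neg2 flip: a_inv_scale)
  ultimately show "\<exists>T\<in>carrier (GL_group K V). T (g w) = L w \<and> (\<forall>x\<in>W. g x = L x \<longrightarrow> T (L x) = L x)"
    using u Lc d \<phi>(2) by (intro bexI) auto
qed

end

section \<open>Inner products and isometries\<close>

locale kspace_ip = kspace +
  fixes ip :: "'a \<Rightarrow> 'a \<Rightarrow> complex"
  assumes ip: "inner_product K V ip"
begin

lemmas ip_facts = ip[unfolded inner_product_def]

lemma ip_K [simp]: "x \<in> carrier V \<Longrightarrow> y \<in> carrier V \<Longrightarrow> ip x y \<in> K"
  by (rule ip_facts[THEN conjunct1, rule_format])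

lemma ip_cnj: "x \<in> carrier V \<Longrightarrow> y \<in> carrier V \<Longrightarrow> ip y x = cnj (ip x y)"
  by (rule ip_facts[THEN conjunct2, THEN conjunct1, rule_format])

lemma ip_left [simp]:
  "x \<in> carrier V \<Longrightarrow> y \<in> carrier V \<Longrightarrow> z \<in> carrier V \<Longrightarrow> ip (x \<oplus> y) z = ip x z + ip y z"
  "a \<in> K \<Longrightarrow> x \<in> carrier V \<Longrightarrow> y \<in> carrier V \<Longrightarrow> ip (a \<odot> x) y = a * ip x y"
  by (rule ip_facts[THEN conjunct2, THEN conjunct2, THEN conjunct1, rule_format]
      ip_facts[THEN conjunct2, THEN conjunct2, THEN conjunct2, THEN conjunct1, rule_format]; assumption)+

lemma ip_pos: "x \<in> carrier V \<Longrightarrow> x \<noteq> \<zero> \<Longrightarrow> 0 < Re (ip x x)"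
  by (rule ip_facts[THEN conjunct2, THEN conjunct2, THEN conjunct2, THEN conjunct2, rule_format])

lemma ip_right [simp]:
  assumes "x \<in> carrier V" "y \<in> carrier V"
  shows "z \<in> carrier V \<Longrightarrow> ip x (y \<oplus> z) = ip x y + ip x z"
    and "a \<in> K \<Longrightarrow> ip x (a \<odot> y) = cnj a * ip x y"
proof -
  show "ip x (y \<oplus> z) = ip x y + ip x z" if "z \<in> carrier V"
    using assms that ip_cnj[of "y \<oplus> z" x] ip_cnj[of y x] ip_cnj[of z x] by simp
  show "ip x (a \<odot> y) = cnj a * ip x y" if "a \<in> K"
    using assms that ip_cnj[of "a \<odot> y" x] ip_cnj[of y x] by simp
qed

lemma ip_norm_eq_iff: "ip_norm ip x = ip_norm ip y \<longleftrightarrow> Re (ip x x) = Re (ip y y)"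
  by (simp add: ip_norm_def)

text \<open>Expanding the norm of a sum recovers the real part of the inner product. Over the
  complex field the imaginary part is, up to sign, the real part after replacing \<open>x\<close> by
  \<open>\<i> \<odot> x\<close>; over the reals it is zero.\<close>

lemma polarization:
  assumes W: "submodule W (scalars K) V" and f: "f \<in> linear_maps K (subspace_of V W) V"
    and norm: "\<And>x. x \<in> W \<Longrightarrow> ip_norm ip (f x) = ip_norm ip x"
    and x: "x \<in> W" and y: "y \<in> W"
  shows "ip (f x) (f y) = ip x y"
proof -
  note Wd = subspaceD[OF W]
  have fc: "f x \<in> carrier V" if "x \<in> W" for x
    using f that by (auto simp: linear_maps_def subspace_of_def)
  have fadd: "f (x \<oplus> y) = f x \<oplus> f y" if "x \<in> W" "y \<in> W" for x y
    using f that by (auto simp: linear_maps_def subspace_of_def)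
  have fscale: "f (a \<odot> x) = a \<odot> f x" if "a \<in> K" "x \<in> W" for a x
    using f that by (auto simp: linear_maps_def subspace_of_def)
  have re: "Re (ip (f x) (f y)) = Re (ip x y)" if x: "x \<in> W" and y: "y \<in> W" for x y
  proof -
    have V: "x \<in> carrier V" "y \<in> carrier V" "f x \<in> carrier V" "f y \<in> carrier V"
      using x y Wd fc by auto
    have "Re (ip (f x \<oplus> f y) (f x \<oplus> f y)) = Re (ip (x \<oplus> y) (x \<oplus> y))"
      using norm[OF Wd(3)[OF x y]] x y by (simp add: ip_norm_eq_iff fadd)
    moreover have "Re (ip (f x) (f x)) = Re (ip x x)" "Re (ip (f y) (f y)) = Re (ip y y)"
      using norm x y by (simp_all add: ip_norm_eq_iff)
    ultimately show ?thesis
      using V ip_cnj[of x y] ip_cnj[of "f x" "f y"] by simp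
  qed
  have V: "x \<in> carrier V" "y \<in> carrier V" "f x \<in> carrier V" "f y \<in> carrier V"
    using x y Wd fc by auto
  have "Im (ip (f x) (f y)) = Im (ip x y)"
    using K
  proof
    assume "K = \<real>"
    then have "ip x y \<in> \<real>" "ip (f x) (f y) \<in> \<real>" using ip_K V by auto
    then show ?thesis by (simp add: complex_is_Real_iff)
  next
    assume K: "K = UNIV"
    then show ?thesis using re[of "\<i> \<odot> x" y] V x y Wd(4)[of \<i> x] fscale by simp
  qed
  with re[OF x y] show ?thesis by (simp add: complex_eq_iff)
qed

lemma O_iff:
  "f \<in> carrier (O_group K V ip) \<longleftrightarrow>
    f \<in> carrier (GL_group K V) \<and> (\<forall>x\<in>carrier V. ip_norm ip (f x) = ip_norm ip x)"
  by (simp add: O_group_def)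

lemma subgroup_O: "subgroup (carrier (O_group K V ip)) (GL_group K V)"
proof (rule group.subgroupI[OF group_GL])
  show "carrier (O_group K V ip) \<subseteq> carrier (GL_group K V)" by (auto simp: O_iff)
  have "\<one>\<^bsub>GL_group K V\<^esub> \<in> carrier (O_group K V ip)"
    using group.is_monoid[OF group_GL] by (simp add: O_iff monoid.one_closed) (simp add: GL_one)
  then show "carrier (O_group K V ip) \<noteq> {}" by blast
  show "inv\<^bsub>GL_group K V\<^esub> f \<in> carrier (O_group K V ip)" if f: "f \<in> carrier (O_group K V ip)" for f
  proof -
    let ?g = "inv\<^bsub>GL_group K V\<^esub> f"
    have g: "?g \<in> carrier (GL_group K V)"
      using f group.inv_closed[OF group_GL] by (simp add: O_iff)
    have "ip_norm ip (?g x) = ip_norm ip x" if "x \<in> carrier V" for x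
    proof -
      have "?g x \<in> carrier V" using g that by (auto simp: GL_iff linear_maps_def)
      then have "ip_norm ip (f (?g x)) = ip_norm ip (?g x)" using f by (simp add: O_iff)
      then show ?thesis using f that by (simp add: O_iff GL_inv_apply)
    qed
    with g show ?thesis by (simp add: O_iff)
  qed
  show "f \<otimes>\<^bsub>GL_group K V\<^esub> g \<in> carrier (O_group K V ip)"
    if f: "f \<in> carrier (O_group K V ip)" and g: "g \<in> carrier (O_group K V ip)" for f g
  proof -
    have "f \<otimes>\<^bsub>GL_group K V\<^esub> g \<in> carrier (GL_group K V)"
      using f g group.is_monoid[OF group_GL] by (simp add: O_iff monoid.m_closed)
    moreover have "g x \<in> carrier V" if "x \<in> carrier V" for x
      using g that by (auto simp: O_iff GL_iff linear_maps_def)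
    ultimately show ?thesis using f g by (simp add: O_iff GL_mult compose_def)
  qed
qed

text \<open>
  For \<open>d = u - v\<close> with \<open>\<bar>u\<bar> = \<bar>v\<bar>\<close> one has \<open>\<bar>d\<bar>\<^sup>2 = 2 Re \<langle>u, d\<rangle>\<close>, which makes
  \<open>x \<mapsto> x - (\<langle>x, d\<rangle> / \<langle>u, d\<rangle>) d\<close> an isometry taking \<open>u\<close> to \<open>v\<close>, over either scalar field. It is
  the Householder reflection when \<open>\<langle>u, d\<rangle>\<close> is real.
\<close>

lemma reflection_exists:
  assumes u: "u \<in> carrier V" and v: "v \<in> carrier V" and ne: "u \<noteq> v"
    and uv: "ip_norm ip u = ip_norm ip v"
  obtains T where "T \<in> carrier (O_group K V ip)" "T u = v"
    "\<And>x. x \<in> carrier V \<Longrightarrow> ip x u = ip x v \<Longrightarrow> T x = x"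
proof -
  define d where "d = u \<oplus> (- 1) \<odot> v"
  have d: "d \<in> carrier V" using u v by (simp add: d_def)
  have "d \<noteq> \<zero>"
  proof
    assume "d = \<zero>"
    then have "u \<ominus> v = \<zero>" using v by (simp add: d_def a_minus_def a_inv_scale)
    moreover have "u = (u \<ominus> v) \<oplus> v" using u v by (simp add: a_minus_def M.a_assoc M.l_neg)
    ultimately show False using ne v by simp
  qed
  then have pos: "0 < Re (ip d d)" using ip_pos d by blast
  define z where "z = ip u d"
  have zK: "z \<in> K" using u d by (simp add: z_def)
  have dd: "Re (ip d d) = 2 * Re z"
    using u v uv ip_cnj[of u v] by (simp add: d_def z_def ip_norm_eq_iff)
  then have z0: "z \<noteq> 0" using pos by auto
  define \<phi> where "\<phi> x = - (ip x d / z)" for x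
  have \<phi>: "\<phi> \<in> functionals"
    using d zK by (auto simp: functionals_def \<phi>_def add_divide_distrib)
  have Im: "Im (ip d d) = 0" using ip_cnj[OF d d] by (simp add: complex_eq_iff)
  have dd': "ip d d = z + cnj z" using dd Im by (simp add: complex_eq_iff)
  \<comment> \<open>The map multiplies \<open>d\<close> by this factor, a complex number of modulus
    1 that is \<open>-1\<close> for real \<open>z\<close>; being nonzero, it makes the map
    bijective.\<close>
  have "1 + \<phi> d = - cnj z / z" using z0 by (simp add: \<phi>_def dd' field_simps)
  then have T: "(\<lambda>x\<in>carrier V. x \<oplus> \<phi> x \<odot> d) \<in> carrier (GL_group K V)"
    using \<phi> d z0 by (intro transvection_GL) auto
  have "Re (ip (x \<oplus> \<phi> x \<odot> d) (x \<oplus> \<phi> x \<odot> d)) = Re (ip x x)" if x: "x \<in> carrier V" for x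
  proof -
    have \<phi>K: "\<phi> x \<in> K" using \<phi> x by (auto simp: functionals_def)
    \<comment> \<open>With \<open>ip x d = - \<phi> x * z\<close> and
      \<open>ip d d = z + cnj z\<close> the bracketed terms cancel.\<close>
    have "ip (x \<oplus> \<phi> x \<odot> d) (x \<oplus> \<phi> x \<odot> d) =
        ip x x + (cnj (\<phi> x) * ip x d + \<phi> x * cnj (ip x d) + \<phi> x * cnj (\<phi> x) * ip d d)"
      using x d \<phi>K ip_cnj[of x d] by (simp add: algebra_simps)
    moreover have "ip x d = - \<phi> x * z" using z0 by (simp add: \<phi>_def)
    ultimately show ?thesis by (simp add: dd' algebra_simps)
  qed
  with T have "(\<lambda>x\<in>carrier V. x \<oplus> \<phi> x \<odot> d) \<in> carrier (O_group K V ip)"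
    by (simp add: O_iff ip_norm_eq_iff)
  moreover have "u \<oplus> \<phi> u \<odot> d = v"
  proof -
    have "u \<oplus> \<phi> u \<odot> d = u \<oplus> (\<ominus> u \<oplus> v)"
      using u v z0 scale_distr(3)[of "- 1" "- 1" v]
      by (simp add: \<phi>_def flip: z_def) (simp add: d_def scale_distr a_inv_scale)
    then show ?thesis using u v by (simp add: M.r_neg2)
  qed
  moreover have "x \<oplus> \<phi> x \<odot> d = x" if "x \<in> carrier V" "ip x u = ip x v" for x
  proof -
    have "\<phi> x = 0" using that u v by (simp add: \<phi>_def d_def)
    then show ?thesis using that d by simp
  qed
  ultimately show ?thesis using u by (intro that[of "\<lambda>x\<in>carrier V. x \<oplus> \<phi> x \<odot> d"]) auto
qed

text \<open>\<open>g w\<close> and \<open>L w\<close> both have the norm of \<open>w\<close>, so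
  \<open>reflection_exists\<close> takes one to the other. Where \<open>g x = L x\<close>,
  polarization for \<open>g\<close> and for \<open>L\<close> shows that \<open>L x\<close> has the
  same inner product \<open>ip x w\<close> with \<open>g w\<close> and with \<open>L w\<close>, so
  \<open>L x\<close> is fixed.\<close>

lemma finite_extension_O:
  assumes W: "submodule W (scalars K) V" and L: "L \<in> linear_maps K (subspace_of V W) V"
    and norm: "\<And>x. x \<in> W \<Longrightarrow> ip_norm ip (L x) = ip_norm ip x" and S: "finite S" "S \<subseteq> W"
  shows "\<exists>g\<in>carrier (O_group K V ip). \<forall>x\<in>S. g x = L x"
proof (rule finite_extension[OF subgroup_O S])
  note Wd = subspaceD[OF W]
  have Lc: "L x \<in> carrier V" if "x \<in> W" for x
    using L that by (auto simp: linear_maps_def subspace_of_def)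
  show "W \<subseteq> carrier V" using Wd by blast
  fix g w assume g: "g \<in> carrier (O_group K V ip)" and w: "w \<in> W" and ne: "g w \<noteq> L w"
  have gn: "ip_norm ip (g x) = ip_norm ip x" if "x \<in> carrier V" for x using g that by (simp add: O_iff)
  \<comment> \<open>The whole carrier is regarded as a subspace, to fit
    \<open>polarization\<close>.\<close>
  have gl: "g \<in> linear_maps K (subspace_of V (carrier V)) V"
    using g by (simp add: O_iff GL_iff linear_maps_def subspace_of_def)
  have gc: "g x \<in> carrier V" if "x \<in> carrier V" for x
    using gl that by (auto simp: linear_maps_def subspace_of_def)
  have wV: "w \<in> carrier V" using w Wd by blast
  obtain T where T: "T \<in> carrier (O_group K V ip)" "T (g w) = L w"
    "\<And>x. x \<in> carrier V \<Longrightarrow> ip x (g w) = ip x (L w) \<Longrightarrow> T x = x"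
    using reflection_exists[OF gc[OF wV] Lc[OF w] ne] gn[OF wV] norm[OF w] by metis
  have "T (L x) = L x" if x: "x \<in> W" "g x = L x" for x
  proof (rule T(3))
    show "L x \<in> carrier V" using Lc x by blast
    have "ip (g x) (g w) = ip x w"
      using polarization[OF carrier_is_submodule gl gn] x wV Wd by blast
    moreover have "ip (L x) (L w) = ip x w"
      using polarization[OF W L norm] x w by blast
    ultimately show "ip (L x) (g w) = ip (L x) (L w)" using x by simp
  qed
  with T show "\<exists>T\<in>carrier (O_group K V ip). T (g w) = L w \<and> (\<forall>x\<in>W. g x = L x \<longrightarrow> T (L x) = L x)"
    by blast
qed

end

section \<open>Linear maps and inner products on subspaces\<close>

lemma linear_maps_closed: "f \<in> linear_maps K V W \<Longrightarrow> x \<in> carrier V \<Longrightarrow> f x \<in> carrier W"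
  by (auto simp: linear_maps_def)

lemma linear_maps_comp:
  "f \<in> linear_maps K V W \<Longrightarrow> g \<in> linear_maps K U V \<Longrightarrow> (\<lambda>x. f (g x)) \<in> linear_maps K U W"
  by (auto simp: linear_maps_def Pi_iff)

lemma linear_maps_domain_subspace:
  "f \<in> linear_maps K V W \<Longrightarrow> U \<subseteq> carrier V \<Longrightarrow> f \<in> linear_maps K (subspace_of V U) W"
  by (auto simp: linear_maps_def subspace_of_def Pi_iff subset_iff)

lemma linear_maps_zero:
  assumes "kspace K V" "kspace K W" "f \<in> linear_maps K V W"
  shows "f \<zero>\<^bsub>V\<^esub> = \<zero>\<^bsub>W\<^esub>"
proof -
  interpret V: kspace K V by fact
  interpret W: kspace K W by fact
  have "f \<zero>\<^bsub>V\<^esub> \<in> carrier W" "f (0 \<odot>\<^bsub>V\<^esub> \<zero>\<^bsub>V\<^esub>) = 0 \<odot>\<^bsub>W\<^esub> f \<zero>\<^bsub>V\<^esub>"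
    using assms(3) V.K_closed(1) V.M.zero_closed unfolding linear_maps_def by blast+
  then show ?thesis by simp
qed

text \<open>For a group element \<open>L\<close> this is the preimage of \<open>U\<close> to which
  \<open>adapted_projection_exists\<close> is applied.\<close>

lemma subspace_preimage:
  assumes "kspace K V" "submodule U (scalars K) V" "f \<in> linear_maps K V V"
  shows "submodule {x \<in> carrier V. f x \<in> U} (scalars K) V"
proof -
  interpret kspace K V by fact
  show ?thesis
    using assms(3) subspaceD[OF assms(2)] linear_maps_zero[OF assms(1,1,3)]
    by (intro subspaceI) (auto simp: linear_maps_def)
qed

lemma inner_product_subspace:
  assumes "\<And>x. x \<in> U \<Longrightarrow> x \<in> carrier V" "inner_product K V ip"
  shows "inner_product K (subspace_of V U) ip"
proof -
  have sub: "carrier (subspace_of V U) \<subseteq> carrier V" using assms(1) by (auto simp: subspace_of_def)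
  have ops: "add (subspace_of V U) = add V" "smult (subspace_of V U) = smult V"
    "zero (subspace_of V U) = zero V"
    by (simp_all add: subspace_of_def)
  show ?thesis
    using assms(2) sub unfolding inner_product_def ops by (elim conjE, intro conjI; meson subsetD)
qed

context
  fixes K :: "complex set" and V :: "(complex, 'v) module" and U :: "'v set" and L :: "'v \<Rightarrow> 'v"
  assumes V: "kspace K V" and U: "submodule U (scalars K) V" and L: "L \<in> linear_maps K V V"
begin

interpretation V: kspace K V by (rule V)

interpretation U: kspace K "subspace_of V U" by (rule V.kspace_subspace[OF U])

text \<open>Stated relative to \<open>subspace_of V U\<close> and not to \<open>V\<close>: the
  extension lemmas are used with \<open>U\<close> as the ambient space, in which \<open>L\<close> is
  only a partially defined map.\<close>

private lemma W: "submodule {x \<in> U. L x \<in> U} (scalars K) (subspace_of V U)"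
proof (rule U.subspaceI)
  have sub: "x \<in> carrier V" if "x \<in> U" for x using that V.subspaceD(1)[OF U] by blast
  show "{x \<in> U. L x \<in> U} \<subseteq> carrier (subspace_of V U)" by (auto simp: subspace_of_def)
  show "\<zero>\<^bsub>subspace_of V U\<^esub> \<in> {x \<in> U. L x \<in> U}"
    using V.subspaceD(2)[OF U] linear_maps_zero[OF V V L] by (simp add: subspace_of_def)
  show "x \<oplus>\<^bsub>subspace_of V U\<^esub> y \<in> {x \<in> U. L x \<in> U}"
    if "x \<in> {x \<in> U. L x \<in> U}" "y \<in> {x \<in> U. L x \<in> U}" for x y
    using that sub L V.subspaceD(3)[OF U] by (simp add: subspace_of_def linear_maps_def)
  show "a \<odot>\<^bsub>subspace_of V U\<^esub> x \<in> {x \<in> U. L x \<in> U}"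
    if "a \<in> K" "x \<in> {x \<in> U. L x \<in> U}" for a x
    using that sub L V.subspaceD(4)[OF U] by (simp add: subspace_of_def linear_maps_def)
qed

private lemma L_restrict:
  "L \<in> linear_maps K (subspace_of (subspace_of V U) {x \<in> U. L x \<in> U}) (subspace_of V U)"
  using linear_maps_closed[OF L] L V.subspaceD(1)[OF U]
  unfolding linear_maps_def subspace_of_def by (simp add: Pi_iff)

lemma finite_extension_GL_subspace:
  assumes "inj_on L (carrier V)" "finite S" "S \<subseteq> {x \<in> U. L x \<in> U}"
  shows "\<exists>g\<in>carrier (GL_group K (subspace_of V U)). \<forall>x\<in>S. g x = L x"
proof (rule U.finite_extension_GL[OF W L_restrict _ assms(2,3)])
  show "inj_on L {x \<in> U. L x \<in> U}"
    using V.subspaceD(1)[OF U] by (intro inj_on_subset[OF assms(1)]) blast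
qed

lemma finite_extension_O_subspace:
  assumes ip: "inner_product K V ip" and norm: "\<And>x. x \<in> carrier V \<Longrightarrow> ip_norm ip (L x) = ip_norm ip x"
    and S: "finite S" "S \<subseteq> {x \<in> U. L x \<in> U}"
  shows "\<exists>g\<in>carrier (O_group K (subspace_of V U) ip). \<forall>x\<in>S. g x = L x"
proof -
  interpret U: kspace_ip K "subspace_of V U" ip
    by unfold_locales (rule inner_product_subspace[OF V.subspaceD(1)[OF U] ip])
  show ?thesis
    by (rule U.finite_extension_O[OF W L_restrict _ S]) (simp add: norm V.subspaceD(1)[OF U])
qed

end

section \<open>Induced maps on formal sums of tuples\<close>

lemma free_map_sum: "free_map I f (sum g A) = (\<Sum>a\<in>A. free_map I f (g a))"
  \<comment> \<open>\<open>OF disjI2, OF refl\<close> instantiates the scalar field of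
    \<open>free_map_add\<close> to \<open>UNIV\<close>.\<close>
  by (induction A rule: infinite_finite_induct)
    (simp_all add: free_map_add[OF disjI2, OF refl], simp_all add: free_map_def)

lemma free_map_comp:
  "free_map I f (free_map I g p) = free_map I (\<lambda>i x. f i (g i x)) p"
proof -
  have "free_map I f (free_map I g p) =
      (\<Sum>x\<in>Poly_Mapping.keys p. free_map I f (Poly_Mapping.single (\<lambda>i\<in>I. g i (x i)) (Poly_Mapping.lookup p x)))"
    by (subst (2) free_map_def) (rule free_map_sum)
  also have "\<dots> = free_map I (\<lambda>i x. f i (g i x)) p"
    unfolding free_map_single[OF disjI2, OF refl] unfolding free_map_def by (simp cong: restrict_cong)
  finally show ?thesis .
qed

text \<open>Only the factors of the tuples occurring in \<open>p\<close> count. This is what allows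
  a group element matching \<open>L\<close> on finitely many vectors to stand in for
  \<open>L\<close>.\<close>

lemma free_map_cong:
  assumes "\<And>x i. x \<in> Poly_Mapping.keys p \<Longrightarrow> i \<in> I \<Longrightarrow> f i (x i) = g i (x i)"
  shows "free_map I f p = free_map I g p"
  unfolding free_map_def
  using assms by (simp cong: restrict_cong sum.cong)

text \<open>A tuple in the extensional product is undefined outside \<open>I\<close>, so restricting
  it to \<open>I\<close> returns the same tuple. Used for group units, for inclusions and for
  projections fixing \<open>U\<close>.\<close>

lemma free_map_ident:
  assumes "p \<in> free_space K (\<Pi>\<^sub>E i\<in>I. A i)" "\<And>i a. i \<in> I \<Longrightarrow> a \<in> A i \<Longrightarrow> f i a = a"
  shows "free_map I f p = p"
proof (rule poly_mapping_eqI)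
  have "(\<lambda>i\<in>I. f i (x i)) = x" if "x \<in> Poly_Mapping.keys p" for x
    using that assms by (intro extensionalityI[of _ I]) (auto simp: free_space_def PiE_iff subset_iff)
  then have "free_map I f p = (\<Sum>x\<in>Poly_Mapping.keys p. Poly_Mapping.single x (Poly_Mapping.lookup p x))"
    unfolding free_map_def by (intro sum.cong refl) simp
  then show "Poly_Mapping.lookup (free_map I f p) y = Poly_Mapping.lookup p y" for y
    by (simp add: lookup_sum lookup_single when_def sum.delta in_keys_iff)
qed

text \<open>Distinct tuples may have the same image and their coefficients may cancel, hence only an
  inclusion. It locates the factors of the representative \<open>r\<close> in
  \<open>tensor_relations_restrict\<close>.\<close>

lemma keys_free_map:
  "Poly_Mapping.keys (free_map I f p) \<subseteq> (\<lambda>x. \<lambda>i\<in>I. f i (x i)) ` Poly_Mapping.keys p"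
proof
  fix y assume y: "y \<in> Poly_Mapping.keys (free_map I f p)"
  have "(\<Sum>x\<in>Poly_Mapping.keys p. Poly_Mapping.lookup (Poly_Mapping.single (\<lambda>i\<in>I. f i (x i)) (Poly_Mapping.lookup p x)) y) \<noteq> 0"
    using y by (simp add: free_map_def in_keys_iff lookup_sum)
  then obtain x where "x \<in> Poly_Mapping.keys p"
    "Poly_Mapping.lookup (Poly_Mapping.single (\<lambda>i\<in>I. f i (x i)) (Poly_Mapping.lookup p x)) y \<noteq> 0"
    by (rule sum.not_neutral_contains_not_neutral)
  then show "y \<in> (\<lambda>x. \<lambda>i\<in>I. f i (x i)) ` Poly_Mapping.keys p"
    by (auto simp: lookup_single when_def split: if_splits)
qed

section \<open>The factorwise action, its orbits, and the descent to the smaller tensor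
  product\<close>

lemma tensor_relations_diff:
  assumes "K = \<real> \<or> K = UNIV" "p \<in> tensor_relations K I V" "q \<in> tensor_relations K I V"
  shows "p - q \<in> tensor_relations K I V"
  using tensor_relations.plus[OF assms(2) tensor_relations_uminus[OF assms(1,3)]] by simp

lemma tensor_map_GL_mult:
  assumes K: "K = \<real> \<or> K = UNIV" and V: "\<And>i. i \<in> I \<Longrightarrow> kspace K (V i)"
    and f: "\<And>i. i \<in> I \<Longrightarrow> f i \<in> carrier (GL_group K (V i))"
    and g: "\<And>i. i \<in> I \<Longrightarrow> g i \<in> carrier (GL_group K (V i))" and X: "X \<in> carrier (tensor_product K I V)"
  shows "tensor_map K I V V (\<lambda>i\<in>I. f i \<otimes>\<^bsub>GL_group K (V i)\<^esub> g i) X = tensor_map K I V V f (tensor_map K I V V g X)"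
proof -
  let ?h = "\<lambda>i\<in>I. f i \<otimes>\<^bsub>GL_group K (V i)\<^esub> g i"
  obtain p where p: "p \<in> free_space K (\<Pi>\<^sub>E i\<in>I. carrier (V i))" "X = tensor_eq K I V `` {p}"
    using tensor_product_cases[OF K X] .
  have lf: "f i \<in> linear_maps K (V i) (V i)" and lg: "g i \<in> linear_maps K (V i) (V i)" if "i \<in> I" for i
    using f g that by (auto simp: GL_iff)
  have h: "?h i = compose (carrier (V i)) (f i) (g i)" if "i \<in> I" for i
    using that f g by (simp add: GL_mult)
  have lh: "?h i \<in> linear_maps K (V i) (V i)" if "i \<in> I" for i
    using monoid.m_closed[OF group.is_monoid[OF kspace.group_GL[OF V[OF that]]] f[OF that] g[OF that]] that
    by (simp add: GL_iff)
  \<comment> \<open>The group product is composition restricted to the carrier, and all factors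
    occurring in \<open>p\<close> lie there.\<close>
  have "free_map I ?h p = free_map I f (free_map I g p)"
    unfolding free_map_comp
  proof (rule free_map_cong)
    fix x i assume "x \<in> Poly_Mapping.keys p" "i \<in> I"
    then have "x i \<in> carrier (V i)" using p(1) by (auto simp: free_space_def)
    then show "?h i (x i) = f i (g i (x i))" using h[OF \<open>i \<in> I\<close>] by (simp add: compose_def)
  qed
  then show ?thesis
    by (simp only: p(2) tensor_map_class[OF K lf] tensor_map_class[OF K lg] tensor_map_class[OF K lh]
        free_map_closed[OF K lg] p(1))
qed

lemma tensor_map_GL_one:
  assumes K: "K = \<real> \<or> K = UNIV" and V: "\<And>i. i \<in> I \<Longrightarrow> kspace K (V i)" and X: "X \<in> carrier (tensor_product K I V)"
  shows "tensor_map K I V V (\<lambda>i\<in>I. \<one>\<^bsub>GL_group K (V i)\<^esub>) X = X"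
proof -
  obtain p where p: "p \<in> free_space K (\<Pi>\<^sub>E i\<in>I. carrier (V i))" "X = tensor_eq K I V `` {p}"
    using tensor_product_cases[OF K X] .
  have l: "(\<lambda>i\<in>I. \<one>\<^bsub>GL_group K (V i)\<^esub>) i \<in> linear_maps K (V i) (V i)" if "i \<in> I" for i
    using monoid.one_closed[OF group.is_monoid[OF kspace.group_GL[OF V[OF that]]]] that by (simp add: GL_iff)
  have "free_map I (\<lambda>i\<in>I. \<one>\<^bsub>GL_group K (V i)\<^esub>) p = p"
    using p(1) by (rule free_map_ident) (simp add: GL_one)
  then show ?thesis by (simp only: p(2) tensor_map_class[OF K l p(1)])
qed

lemma group_restrict_GL:
  "kspace K V \<Longrightarrow> subgroup H (GL_group K V) \<Longrightarrow> group (GL_group K V\<lparr>carrier := H\<rparr>)"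
  by (rule subgroup.subgroup_is_group[OF _ kspace.group_GL])

text \<open>Closure under products gives one inclusion; applying it to the inverse of
  \<open>f\<close> gives the other. Arbitrary subgroups \<open>H i\<close> cover the linear and the
  orthogonal groups together.\<close>

lemma orbit_tensor_map:
  fixes K :: "complex set" and I :: "'i set" and H :: "'i \<Rightarrow> ('v \<Rightarrow> 'v) set"
  defines "P \<equiv> \<lambda>V. product_group I (\<lambda>i. GL_group K (V i)\<lparr>carrier := H i\<rparr>)"
  assumes K: "K = \<real> \<or> K = UNIV" and V: "\<And>i. i \<in> I \<Longrightarrow> kspace K (V i)"
    and H: "\<And>i. i \<in> I \<Longrightarrow> subgroup (H i) (GL_group K (V i))"
    and f: "f \<in> (\<Pi>\<^sub>E i\<in>I. H i)" and X: "X \<in> carrier (tensor_product K I V)"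
  shows "orbit (P V) (tensor_map K I V V) (tensor_map K I V V f X) = orbit (P V) (tensor_map K I V V) X"
proof -
  let ?t = "tensor_map K I V V"
  have P: "group (P V)"
    unfolding P_def using group_restrict_GL V H by (intro product_group) blast
  have HG: "h i \<in> carrier (GL_group K (V i))" if "h \<in> (\<Pi>\<^sub>E i\<in>I. H i)" "i \<in> I" for h i
    using that subgroup.subset[OF H] by blast
  have mult: "?t (h \<otimes>\<^bsub>P V\<^esub> g) Y = ?t h (?t g Y)"
    if "h \<in> carrier (P V)" "g \<in> carrier (P V)" "Y \<in> carrier (tensor_product K I V)" for h g Y
    using tensor_map_GL_mult[OF K V _ _ that(3), of h g] HG that by (simp add: P_def)
  have closed: "?t h Y \<in> carrier (tensor_product K I V)"
    if "h \<in> carrier (P V)" "Y \<in> carrier (tensor_product K I V)" for h Y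
  proof -
    have "?t h \<in> linear_maps K (tensor_product K I V) (tensor_product K I V)"
      using HG that by (intro tensor_map_linear[OF K]) (auto simp: P_def GL_iff)
    then show ?thesis using that by (auto simp: linear_maps_def)
  qed
  have sub: "orbit (P V) ?t (?t h Y) \<subseteq> orbit (P V) ?t Y"
    if "h \<in> carrier (P V)" "Y \<in> carrier (tensor_product K I V)" for h Y
    using that mult monoid.m_closed[OF group.is_monoid[OF P]] unfolding orbit_def by (auto simp flip: mult)
  have f: "f \<in> carrier (P V)" using f by (simp add: P_def)
  have "?t (inv\<^bsub>P V\<^esub> f) (?t f X) = ?t (inv\<^bsub>P V\<^esub> f \<otimes>\<^bsub>P V\<^esub> f) X"
    using mult[OF group.inv_closed[OF P f] f X] by simp
  also have "\<dots> = X"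
    using tensor_map_GL_one[OF K V X] group.l_inv[OF P f] by (simp add: P_def)
  finally have "orbit (P V) ?t X \<subseteq> orbit (P V) ?t (?t f X)"
    using sub[OF group.inv_closed[OF P f] closed[OF f X]] by simp
  with sub[OF f X] show ?thesis by blast
qed

text \<open>A chain of congruences between formal sums. Let \<open>r\<close> be the image of
  \<open>q\<close> under the maps \<open>P i\<close> after the inverse of \<open>L i\<close>. Modulo
  the relations of the \<open>U i\<close>, \<open>p\<close> is congruent to \<open>r\<close>, hence
  \<open>M' p\<close> to \<open>M' r = L r\<close>. That \<open>L r\<close> is congruent to
  \<open>q\<close> holds first modulo the relations of the \<open>V i\<close>, then modulo those of
  the \<open>U i\<close>, because \<open>P\<close> carries relations to relations and fixes both
  sides.\<close>

lemma tensor_relations_restrict: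
  assumes K: "K = \<real> \<or> K = UNIV" and V: "\<And>i. i \<in> I \<Longrightarrow> kspace K (V i)"
    and U: "\<And>i. i \<in> I \<Longrightarrow> submodule (U i) (scalars K) (V i)"
    and L: "\<And>i. i \<in> I \<Longrightarrow> L i \<in> carrier (GL_group K (V i))"
    and p: "p \<in> free_space K (\<Pi>\<^sub>E i\<in>I. U i)" and q: "q \<in> free_space K (\<Pi>\<^sub>E i\<in>I. U i)"
    and rel: "free_map I L p - q \<in> tensor_relations K I V"
    and ext: "\<And>i S. i \<in> I \<Longrightarrow> finite S \<Longrightarrow> S \<subseteq> {x \<in> U i. L i x \<in> U i} \<Longrightarrow>
      \<exists>g\<in>H i. \<forall>x\<in>S. g x = L i x"
    and H: "\<And>i. i \<in> I \<Longrightarrow> H i \<subseteq> linear_maps K (subspace_of (V i) (U i)) (subspace_of (V i) (U i))"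
  shows "\<exists>M\<in>(\<Pi>\<^sub>E i\<in>I. H i). free_map I M p - q \<in> tensor_relations K I (\<lambda>i. subspace_of (V i) (U i))"
proof -
  let ?U = "\<lambda>i. subspace_of (V i) (U i)"
  note minus = free_map_minus[OF K]
  have Lc: "L i x \<in> carrier (V i)" if "i \<in> I" "x \<in> carrier (V i)" for i x
    using L[OF that(1)] that(2) by (auto simp: GL_iff intro: linear_maps_closed)
  have UV: "x \<in> carrier (V i)" if "i \<in> I" "x \<in> U i" for i x
    using kspace.subspaceD(1)[OF V U] that by blast
  have keysU: "x i \<in> U i" if "x \<in> Poly_Mapping.keys r" "i \<in> I" "r \<in> free_space K (\<Pi>\<^sub>E i\<in>I. U i)" for r x i
    using that by (auto simp: free_space_def)
  define N where "N i = inv\<^bsub>GL_group K (V i)\<^esub> (L i)" for i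
  have N: "N i \<in> linear_maps K (V i) (V i)" "\<And>x. x \<in> carrier (V i) \<Longrightarrow> N i (L i x) = x"
    "\<And>x. x \<in> carrier (V i) \<Longrightarrow> L i (N i x) = x" "\<And>x. x \<in> carrier (V i) \<Longrightarrow> N i x \<in> carrier (V i)"
    if "i \<in> I" for i
  proof -
    interpret kspace K "V i" using V that .
    have "N i \<in> carrier (GL_group K (V i))"
      unfolding N_def using group.inv_closed[OF group_GL L[OF that]] .
    then show l: "N i \<in> linear_maps K (V i) (V i)" by (simp add: GL_iff)
    show "x \<in> carrier (V i) \<Longrightarrow> N i x \<in> carrier (V i)" for x
      by (rule linear_maps_closed[OF l])
    show "x \<in> carrier (V i) \<Longrightarrow> N i (L i x) = x" "x \<in> carrier (V i) \<Longrightarrow> L i (N i x) = x" for x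
      using GL_inv_apply[OF L[OF that]] by (auto simp: N_def)
  qed
  have "\<exists>P. P \<in> linear_maps K (V i) (?U i) \<and> (\<forall>x\<in>U i. P x = x) \<and>
      (\<forall>x\<in>carrier (V i). L i x \<in> U i \<longrightarrow> L i (P x) \<in> U i)" if i: "i \<in> I" for i
  proof -
    have l: "L i \<in> linear_maps K (V i) (V i)" using L[OF i] by (simp add: GL_iff)
    note kspace.adapted_projection_exists[OF V[OF i] U[OF i] subspace_preimage[OF V[OF i] U[OF i] l]]
    then show ?thesis by (metis (no_types, lifting) mem_Collect_eq)
  qed
  then obtain P where P: "\<And>i. i \<in> I \<Longrightarrow> P i \<in> linear_maps K (V i) (?U i)"
    "\<And>i x. i \<in> I \<Longrightarrow> x \<in> U i \<Longrightarrow> P i x = x"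
    "\<And>i x. i \<in> I \<Longrightarrow> x \<in> carrier (V i) \<Longrightarrow> L i x \<in> U i \<Longrightarrow> L i (P i x) \<in> U i"
    by metis
  have Pc: "P i x \<in> U i" if "i \<in> I" "x \<in> carrier (V i)" for i x
    using linear_maps_closed[OF P(1)[OF that(1)] that(2)] by (simp add: subspace_of_def)
  have PN: "(\<lambda>x. P i (N i x)) \<in> linear_maps K (V i) (?U i)" if "i \<in> I" for i
    by (rule linear_maps_comp[OF P(1)[OF that] N(1)[OF that]])
  define r where "r = free_map I (\<lambda>i x. P i (N i x)) q"
  have rkeys: "y i \<in> U i \<and> L i (y i) \<in> U i" if y: "y \<in> Poly_Mapping.keys r" and i: "i \<in> I" for y i
  proof -
    obtain x where x: "x \<in> Poly_Mapping.keys q" "y = (\<lambda>i\<in>I. P i (N i (x i)))"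
      using subsetD[OF keys_free_map y[unfolded r_def]] by auto
    \<comment> \<open>\<open>N i\<close> takes \<open>x i\<close> into the preimage of
      \<open>U i\<close> under \<open>L i\<close>; \<open>P i\<close> keeps it there and moves it
      into \<open>U i\<close>.\<close>
    have "x i \<in> U i" using keysU[OF x(1) i q] .
    then show ?thesis using x(2) i Pc P(3) N UV by simp
  qed
  \<comment> \<open>On \<open>U i\<close> the maps \<open>L i\<close>, \<open>N i\<close>,
    \<open>P i\<close> in turn compose to the identity, so applying the last two to
    \<open>rel\<close> compares \<open>p\<close> with \<open>r\<close>, already over the
    \<open>U i\<close>.\<close>
  have "free_map I (\<lambda>i x. P i (N i x)) (free_map I L p) = p"
    unfolding free_map_comp using p by (rule free_map_ident) (simp add: N UV P)
  then have pr: "p - r \<in> tensor_relations K I ?U"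
    using free_map_relations[OF K PN rel] by (simp add: r_def minus)
  \<comment> \<open>Only finitely many vectors occur as \<open>i\<close>-th factors in
    \<open>r\<close>, so \<open>ext\<close> supplies one group element matching \<open>L i\<close>
    on all of them.\<close>
  have "\<exists>g\<in>H i. \<forall>y\<in>Poly_Mapping.keys r. g (y i) = L i (y i)" if "i \<in> I" for i
    using ext[OF that, of "(\<lambda>y. y i) ` Poly_Mapping.keys r"] rkeys that by auto
  then obtain M where M: "\<And>i. i \<in> I \<Longrightarrow> M i \<in> H i"
    "\<And>i y. i \<in> I \<Longrightarrow> y \<in> Poly_Mapping.keys r \<Longrightarrow> M i (y i) = L i (y i)"
    by metis
  define M' where "M' = (\<lambda>i\<in>I. M i)"
  have M': "M' \<in> (\<Pi>\<^sub>E i\<in>I. H i)" using M by (simp add: M'_def)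
  have Ml: "M' i \<in> linear_maps K (?U i) (?U i)" if "i \<in> I" for i
    using M(1) H that by (auto simp: M'_def)
  have "free_map I M' r = free_map I L r" using M by (intro free_map_cong) (simp add: M'_def)
  then have 1: "free_map I M' p - free_map I L r \<in> tensor_relations K I ?U"
    using free_map_relations[OF K Ml pr] by (simp add: minus)
  \<comment> \<open>\<open>L\<close> pushes the relation between \<open>p\<close> and
    \<open>r\<close> into the larger spaces, where \<open>rel\<close> links \<open>L p\<close> to
    \<open>q\<close>.\<close>
  have incl: "L i \<in> linear_maps K (?U i) (V i)" if "i \<in> I" for i
    using L[OF that] UV[OF that] by (intro linear_maps_domain_subspace) (auto simp: GL_iff)
  have "free_map I L p - free_map I L r \<in> tensor_relations K I V"
    using free_map_relations[OF K incl pr] by (simp add: minus)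
  from tensor_relations_diff[OF K rel this]
  have "free_map I L r - q \<in> tensor_relations K I V" by simp
  \<comment> \<open>\<open>P\<close> brings the relation back to the \<open>U i\<close>; it fixes
    \<open>q\<close> and, by \<open>rkeys\<close>, also \<open>free_map I L r\<close>.\<close>
  then have "free_map I P (free_map I L r) - free_map I P q \<in> tensor_relations K I ?U"
    using free_map_relations[OF K P(1)] by (simp flip: minus)
  moreover have "free_map I P q = q" using q P(2) by (rule free_map_ident)
  moreover have "free_map I P (free_map I L r) = free_map I L r"
    unfolding free_map_comp using rkeys P(2) by (intro free_map_cong) auto
  ultimately have "free_map I L r - q \<in> tensor_relations K I ?U" by simp
  from tensor_relations.plus[OF 1 this] M' show ?thesis by auto
qed

text \<open>Equal orbits in the large space yield one family \<open>L\<close> with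
  \<open>L B = B'\<close>; on representatives, \<open>tensor_relations_restrict\<close> turns it
  into a family \<open>M\<close> over the \<open>U i\<close>. The groups enter only as subgroups
  linked by \<open>ext\<close>, so both parts of the theorem are instances.\<close>

lemma orbit_eq_of_inclusion:
  assumes K: "K = \<real> \<or> K = UNIV" and V: "\<And>i. i \<in> I \<Longrightarrow> kspace K (V i)"
    and U: "\<And>i. i \<in> I \<Longrightarrow> submodule (U i) (scalars K) (V i)"
    and HV: "\<And>i. i \<in> I \<Longrightarrow> subgroup (HV i) (GL_group K (V i))"
    and HU: "\<And>i. i \<in> I \<Longrightarrow> subgroup (HU i) (GL_group K (subspace_of (V i) (U i)))"
    and ext: "\<And>i L S. i \<in> I \<Longrightarrow> L \<in> HV i \<Longrightarrow> finite S \<Longrightarrow> S \<subseteq> {x \<in> U i. L x \<in> U i} \<Longrightarrow>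
      \<exists>g\<in>HU i. \<forall>x\<in>S. g x = L x"
    and B: "B \<in> carrier (tensor_product K I (\<lambda>i. subspace_of (V i) (U i)))"
    and B': "B' \<in> carrier (tensor_product K I (\<lambda>i. subspace_of (V i) (U i)))"
    and eq: "orbit (product_group I (\<lambda>i. GL_group K (V i)\<lparr>carrier := HV i\<rparr>)) (tensor_map K I V V)
        (tensor_inclusion K I U V B) =
      orbit (product_group I (\<lambda>i. GL_group K (V i)\<lparr>carrier := HV i\<rparr>)) (tensor_map K I V V)
        (tensor_inclusion K I U V B')"
  shows "orbit (product_group I (\<lambda>i. GL_group K (subspace_of (V i) (U i))\<lparr>carrier := HU i\<rparr>))
        (tensor_map K I (\<lambda>i. subspace_of (V i) (U i)) (\<lambda>i. subspace_of (V i) (U i))) B =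
      orbit (product_group I (\<lambda>i. GL_group K (subspace_of (V i) (U i))\<lparr>carrier := HU i\<rparr>))
        (tensor_map K I (\<lambda>i. subspace_of (V i) (U i)) (\<lambda>i. subspace_of (V i) (U i))) B'"
proof -
  let ?U = "\<lambda>i. subspace_of (V i) (U i)"
  let ?G = "product_group I (\<lambda>i. GL_group K (V i)\<lparr>carrier := HV i\<rparr>)"
  have carU: "carrier (?U i) = U i" for i by (simp add: subspace_of_def)
  have UV: "x \<in> carrier (V i)" if "i \<in> I" "x \<in> U i" for i x
    using kspace.subspaceD(1)[OF V U] that by blast
  obtain p where p: "p \<in> free_space K (\<Pi>\<^sub>E i\<in>I. U i)" "B = tensor_eq K I ?U `` {p}"
    using tensor_product_cases[OF K B] unfolding carU .
  obtain q where q: "q \<in> free_space K (\<Pi>\<^sub>E i\<in>I. U i)" "B' = tensor_eq K I ?U `` {q}"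
    using tensor_product_cases[OF K B'] unfolding carU .
  have idl: "(\<lambda>x. x) \<in> linear_maps K (?U i) (V i)" if "i \<in> I" for i
    using UV[OF that] by (auto simp: linear_maps_def subspace_of_def)
  \<comment> \<open>The inclusion leaves representatives unchanged: the same formal sum stands for a
    class over the \<open>U i\<close> and for its image over the \<open>V i\<close>.\<close>
  have incl: "tensor_inclusion K I U V (tensor_eq K I ?U `` {s}) = tensor_eq K I V `` {s}"
    "s \<in> free_space K (\<Pi>\<^sub>E i\<in>I. carrier (V i))"
    if s: "s \<in> free_space K (\<Pi>\<^sub>E i\<in>I. U i)" for s
  proof -
    have e: "free_map I (\<lambda>i x. x) s = s" using s by (rule free_map_ident) simp
    have s': "s \<in> free_space K (\<Pi>\<^sub>E i\<in>I. carrier (?U i))" using s by (simp only: carU)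
    show "tensor_inclusion K I U V (tensor_eq K I ?U `` {s}) = tensor_eq K I V `` {s}"
      unfolding tensor_inclusion_def using tensor_map_class[OF K idl s'] by (simp only: e)
    show "s \<in> free_space K (\<Pi>\<^sub>E i\<in>I. carrier (V i))"
      using free_map_closed[OF K idl s'] by (simp only: e)
  qed
  have B'V: "tensor_inclusion K I U V B' \<in> carrier (tensor_product K I V)"
    using incl[OF q(1)] q(2) tensor_class_closed[OF K] by simp
  \<comment> \<open>The unit puts the image of \<open>B'\<close> in its own orbit, hence by
    \<open>eq\<close> in the orbit of the image of \<open>B\<close>; this produces
    \<open>L\<close>.\<close>
  have one: "(\<lambda>i\<in>I. \<one>\<^bsub>GL_group K (V i)\<^esub>) \<in> carrier ?G"
    using subgroup.one_closed[OF HV] by simp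
  have "tensor_inclusion K I U V B' \<in> orbit ?G (tensor_map K I V V) (tensor_inclusion K I U V B')"
    unfolding orbit_def using one tensor_map_GL_one[OF K V B'V] by (metis (mono_tags, lifting) mem_Collect_eq)
  then obtain L where L: "L \<in> (\<Pi>\<^sub>E i\<in>I. HV i)"
    and LB: "tensor_inclusion K I U V B' = tensor_map K I V V L (tensor_inclusion K I U V B)"
    unfolding eq[symmetric] by (auto simp: orbit_def)
  have LG: "L i \<in> carrier (GL_group K (V i))" if "i \<in> I" for i
    using L subgroup.subset[OF HV] that by blast
  then have Ll: "L i \<in> linear_maps K (V i) (V i)" if "i \<in> I" for i using that by (simp add: GL_iff)
  have "tensor_eq K I V `` {free_map I L p} = tensor_eq K I V `` {q}"
    using LB tensor_map_class[OF K Ll incl(2)[OF p(1)]] by (simp add: p q incl)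
  then have rel: "free_map I L p - q \<in> tensor_relations K I V"
    using tensor_class_eq_iff[OF K free_map_closed[OF K Ll incl(2)[OF p(1)]] incl(2)[OF q(1)]] by blast
  have HUl: "HU i \<subseteq> linear_maps K (?U i) (?U i)" if "i \<in> I" for i
    using subgroup.subset[OF HU[OF that]] by (auto simp: GL_iff)
  have ext': "\<exists>g\<in>HU i. \<forall>x\<in>S. g x = L i x"
    if "i \<in> I" "finite S" "S \<subseteq> {x \<in> U i. L i x \<in> U i}" for i S
    using ext[OF that(1) PiE_mem[OF L that(1)] that(2,3)] .
  obtain M where M: "M \<in> (\<Pi>\<^sub>E i\<in>I. HU i)" and Mpq: "free_map I M p - q \<in> tensor_relations K I ?U"
    using tensor_relations_restrict[OF K V U LG p(1) q(1) rel ext' HUl] by blast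
  have Ml: "M i \<in> linear_maps K (?U i) (?U i)" if "i \<in> I" for i using M HUl that by blast
  have p': "p \<in> free_space K (\<Pi>\<^sub>E i\<in>I. carrier (?U i))" and q': "q \<in> free_space K (\<Pi>\<^sub>E i\<in>I. carrier (?U i))"
    using p q by (simp_all only: carU)
  have "tensor_eq K I ?U `` {free_map I M p} = tensor_eq K I ?U `` {q}"
    using tensor_class_eq_iff[OF K free_map_closed[OF K Ml p'] q'] Mpq by blast
  then have "tensor_map K I ?U ?U M B = B'"
    using tensor_map_class[OF K Ml p'] by (simp add: p(2) q(2))
  moreover have "kspace K (?U i)" if "i \<in> I" for i using kspace.kspace_subspace[OF V U] that by blast
  ultimately show ?thesis using orbit_tensor_map[OF K _ HU M B] by simp
qed

section \<open>Orbits under the full linear and the orthogonal groups\<close>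

theorem theorem7p5:
  fixes K :: "complex set" and k :: nat
    and V :: "nat \<Rightarrow> (complex, 'v) module" and U :: "nat \<Rightarrow> 'v set"
    and ip :: "nat \<Rightarrow> 'v \<Rightarrow> 'v \<Rightarrow> complex"
    and B B' :: "((nat \<Rightarrow> 'v) \<Rightarrow>\<^sub>0 complex) set"
  assumes "K = \<real> \<or> K = UNIV"
    and "\<And>i. i \<in> {1..k} \<Longrightarrow> module (scalars K) (V i)"
    and "\<And>i. i \<in> {1..k} \<Longrightarrow> submodule (U i) (scalars K) (V i)"
    and "B \<in> carrier (tensor_product K {1..k} (\<lambda>i. subspace_of (V i) (U i)))"
    and "B' \<in> carrier (tensor_product K {1..k} (\<lambda>i. subspace_of (V i) (U i)))"
  shows
    "(GL_orbit K {1..k} (\<lambda>i. subspace_of (V i) (U i)) B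
        \<noteq> GL_orbit K {1..k} (\<lambda>i. subspace_of (V i) (U i)) B'
      \<longrightarrow> GL_orbit K {1..k} V (tensor_inclusion K {1..k} U V B)
        \<noteq> GL_orbit K {1..k} V (tensor_inclusion K {1..k} U V B'))
   \<and> ((\<forall>i\<in>{1..k}. inner_product K (V i) (ip i))
      \<longrightarrow> O_orbit K {1..k} (\<lambda>i. subspace_of (V i) (U i)) ip B
        \<noteq> O_orbit K {1..k} (\<lambda>i. subspace_of (V i) (U i)) ip B'
      \<longrightarrow> O_orbit K {1..k} V ip (tensor_inclusion K {1..k} U V B)
        \<noteq> O_orbit K {1..k} V ip (tensor_inclusion K {1..k} U V B'))"
proof -
  let ?I = "{1..k}" and ?U = "\<lambda>i. subspace_of (V i) (U i)"
  have V: "kspace K (V i)" if "i \<in> ?I" for i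
    using assms(1) assms(2)[OF that] by (simp add: kspace_def)
  have U: "kspace K (?U i)" if "i \<in> ?I" for i
    using kspace.kspace_subspace[OF V[OF that] assms(3)[OF that]] .
  \<comment> \<open>Both parts go by contraposition: \<open>reduce\<close> deduces equal orbits over
    the \<open>U i\<close> from equal orbits over the \<open>V i\<close>.\<close>
  note reduce = orbit_eq_of_inclusion[OF assms(1) V assms(3) _ _ _ assms(4,5)]
  have "GL_orbit K ?I ?U B = GL_orbit K ?I ?U B'"
    if eq: "GL_orbit K ?I V (tensor_inclusion K ?I U V B) = GL_orbit K ?I V (tensor_inclusion K ?I U V B')"
  proof -
    let ?HV = "\<lambda>i. carrier (GL_group K (V i))" and ?HU = "\<lambda>i. carrier (GL_group K (?U i))"
    \<comment> \<open>Replacing the carrier by itself gives the group the form of a subgroup of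
      \<open>GL_group\<close> that \<open>reduce\<close> expects.\<close>
    have GL: "GL_orbit K ?I W = orbit (product_group ?I
        (\<lambda>i. GL_group K (W i)\<lparr>carrier := carrier (GL_group K (W i))\<rparr>)) (tensor_map K ?I W W)"
      for W :: "nat \<Rightarrow> (complex, 'v) module"
      by (simp add: GL_orbit_def fun_eq_iff)
    show ?thesis
      unfolding GL
    proof (rule reduce[OF _ _ _ _ _ eq[unfolded GL]])
      show "subgroup (?HV i) (GL_group K (V i))" if "i \<in> ?I" for i
        using group.subgroup_self[OF kspace.group_GL[OF V[OF that]]] .
      show "subgroup (?HU i) (GL_group K (?U i))" if "i \<in> ?I" for i
        using group.subgroup_self[OF kspace.group_GL[OF U[OF that]]] .
      \<comment> \<open>Elements of the large group are injective on \<open>V i\<close>, as the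
        extension lemma demands.\<close>
      show "\<exists>g\<in>?HU i. \<forall>x\<in>S. g x = L x"
        if "i \<in> ?I" "L \<in> ?HV i" "finite S" "S \<subseteq> {x \<in> U i. L x \<in> U i}" for i L S
        using finite_extension_GL_subspace[OF V assms(3)] that by (simp add: GL_iff bij_betw_def)
    qed
  qed
  moreover have "O_orbit K ?I ?U ip B = O_orbit K ?I ?U ip B'"
    if ip: "\<forall>i\<in>?I. inner_product K (V i) (ip i)"
      and eq: "O_orbit K ?I V ip (tensor_inclusion K ?I U V B) = O_orbit K ?I V ip (tensor_inclusion K ?I U V B')"
  proof -
    let ?HV = "\<lambda>i. carrier (O_group K (V i) (ip i))" and ?HU = "\<lambda>i. carrier (O_group K (?U i) (ip i))"
    \<comment> \<open>The orthogonal group is by definition \<open>GL_group\<close> with a smaller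
      carrier.\<close>
    have O: "O_orbit K ?I W ip = orbit (product_group ?I
        (\<lambda>i. GL_group K (W i)\<lparr>carrier := carrier (O_group K (W i) (ip i))\<rparr>)) (tensor_map K ?I W W)"
      for W :: "nat \<Rightarrow> (complex, 'v) module"
      by (simp add: O_orbit_def O_group_def fun_eq_iff)
    show ?thesis
      unfolding O
    proof (rule reduce[OF _ _ _ _ _ eq[unfolded O]])
      show "subgroup (?HV i) (GL_group K (V i))" if "i \<in> ?I" for i
        using V ip that by (intro kspace_ip.subgroup_O) (auto simp: kspace_ip_def kspace_ip_axioms_def)
      show "subgroup (?HU i) (GL_group K (?U i))" if "i \<in> ?I" for i
        using U[OF that] ip that kspace.subspaceD(1)[OF V[OF that] assms(3)[OF that]]
        by (intro kspace_ip.subgroup_O kspace_ip.intro kspace_ip_axioms.intro inner_product_subspace) auto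
      show "\<exists>g\<in>?HU i. \<forall>x\<in>S. g x = L x"
        if i: "i \<in> ?I" and L: "L \<in> ?HV i" and S: "finite S" "S \<subseteq> {x \<in> U i. L x \<in> U i}" for i L S
      proof -
        have "L \<in> linear_maps K (V i) (V i)" "\<And>x. x \<in> carrier (V i) \<Longrightarrow> ip_norm (ip i) (L x) = ip_norm (ip i) x"
          using L by (auto simp: O_group_def GL_iff)
        then show ?thesis
          using finite_extension_O_subspace[OF V[OF i] assms(3)[OF i]] ip i S by blast
      qed
    qed
  qed
  ultimately show ?thesis by blast
qed

end
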